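(* Let $G$ be a group, let $M=G^0=G\sqcup\{0\}$ be the monoid obtained from $G$ by adjoining a zero element, and let $\alpha$ be a strong partial action of $M$ on a semigroup $X$ such that $\operatorname{dom}\alpha_m$ and $\operatorname{im}\alpha_m$ are ideals of $X$ for all $m\in M$. Then $\alpha$ is globalizable (in the category of semigroups) if and only if both of the following conditions hold: (LC1) for all $g\in G$ and $x,y,z\in X$ with $y\in\operatorname{dom}\alpha_g$: $\alpha_{g^{-1}}(\alpha_g(xy)z)=x\,\alpha_{g^{-1}}(\alpha_g(y)z)$; (LC2) for all $m\in M$, $y\in\operatorname{dom}\alpha_m$ and $x,z\in X^1$: if $xyz\in\operatorname{dom}\alpha_0$, then $x\alpha_m(y)z\in\operatorname{dom}\alpha_0$ and $\alpha_0(xyz)=\alpha_0(x\alpha_m(y)z)$.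
   Context: Let $M$ be a monoid with identity $e$. A strong partial action of $M$ on a set $X$ is a family $\alpha=\{\alpha_m:\operatorname{dom}\alpha_m\to X\}_{m\in M}$ of maps with $\operatorname{dom}\alpha_m\subseteq X$ such that: (1) $\operatorname{dom}\alpha_e=X$ and $\alpha_e=\mathrm{id}_X$; (2) $\alpha_m^{-1}(\operatorname{dom}\alpha_n)=\operatorname{dom}\alpha_{nm}\cap\operatorname{dom}\alpha_m$ for all $m,n\in M$; (3) $\alpha_n\circ\alpha_m=\alpha_{nm}$ on $\alpha_m^{-1}(\operatorname{dom}\alpha_n)$ for all $m,n\in M$. It is a global action if $\operatorname{dom}\alpha_m=X$ for all $m$. A strong partial action (global action) of $M$ on a semigroup $X$ is one on the underlying set such that each $\operatorname{dom}\alpha_m$ is a subsemigroup of $X$ and each $\alpha_m$ is a semigroup homomorphism. Write $\operatorname{im}\alpha_m=\alpha_m(\operatorname{dom}\alpha_m)$. Ideals are two-sided; subsemigroups and ideals are allowed to be empty. $X^1$ denotes the semigroup $X$ with an identity element $1$ adjoined. If $\alpha$ is a strong partial action of $M$ on a semigroup $X$ and $\beta$ is a global action of $M$ on a semigroup $Y$, a morphism $\iota:\alpha\to\beta$ is a semigroup homomorphism $\iota:X\to Y$ with $\beta_m(\iota(x))=\iota(\alpha_m(x))$ for all $m\in M$, $x\in\operatorname{dom}\alpha_m$. A globalization of $\alpha$ is a pair $(\beta,\iota)$, with $\beta$ a global action of $M$ on a semigroup and $\iota:\alpha\to\beta$ a morphism, such that for all $x,y\in X$ and $m\in M$ with $\beta_m(\iota(x))=\iota(y)$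 one has $x\in\operatorname{dom}\alpha_m$ and $\alpha_m(x)=y$. $\alpha$ is globalizable if it has a globalization. *)

theory Defs
  imports "HOL-Algebra.Group"
begin

section \<open>Semigroups\<close>

record 'a sgroup = "'a partial_object" +
  sg_mult :: "'a \<Rightarrow> 'a \<Rightarrow> 'a" (infixl "\<cdot>\<index>" 70)

text \<open>The carrier may be empty.\<close>

definition is_sgroup :: "('a, 'c) sgroup_scheme \<Rightarrow> bool" where
  "is_sgroup X \<longleftrightarrow>
     (\<forall>x\<in>carrier X. \<forall>y\<in>carrier X. x \<cdot>\<^bsub>X\<^esub> y \<in> carrier X) \<and>
     (\<forall>x\<in>carrier X. \<forall>y\<in>carrier X. \<forall>z\<in>carrier X.
        (x \<cdot>\<^bsub>X\<^esub> y) \<cdot>\<^bsub>X\<^esub> z = x \<cdot>\<^bsub>X\<^esub> (y \<cdot>\<^bsub>X\<^esub> z))"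

definition subsgroup :: "'a set \<Rightarrow> ('a, 'c) sgroup_scheme \<Rightarrow> bool" where
  "subsgroup S X \<longleftrightarrow> S \<subseteq> carrier X \<and> (\<forall>x\<in>S. \<forall>y\<in>S. x \<cdot>\<^bsub>X\<^esub> y \<in> S)"

definition sg_ideal :: "'a set \<Rightarrow> ('a, 'c) sgroup_scheme \<Rightarrow> bool" where
  "sg_ideal I X \<longleftrightarrow> I \<subseteq> carrier X \<and>
     (\<forall>i\<in>I. \<forall>x\<in>carrier X. x \<cdot>\<^bsub>X\<^esub> i \<in> I \<and> i \<cdot>\<^bsub>X\<^esub> x \<in> I)"

definition sg_hom :: "('a, 'c) sgroup_scheme \<Rightarrow> ('b, 'd) sgroup_scheme \<Rightarrow> ('a \<Rightarrow> 'b) set" where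
  "sg_hom X Y = {h \<in> carrier X \<rightarrow> carrier Y.
     \<forall>x\<in>carrier X. \<forall>y\<in>carrier X. h (x \<cdot>\<^bsub>X\<^esub> y) = h x \<cdot>\<^bsub>Y\<^esub> h y}"

text \<open>The semigroup with an identity \<open>None\<close> adjoined; \<open>Some\<close> is the inclusion. A new
  identity is adjoined even if there already is one.\<close>

definition adjoin_one :: "('a, 'c) sgroup_scheme \<Rightarrow> 'a option monoid" where
  "adjoin_one X = \<lparr>carrier = insert None (Some ` carrier X),
     mult = (\<lambda>u v. case (u, v) of
               (Some x, Some y) \<Rightarrow> Some (x \<cdot>\<^bsub>X\<^esub> y)
             | (None, _) \<Rightarrow> v
             | (_, None) \<Rightarrow> u),
     one = None\<rparr>"

text \<open>The monoid with a zero \<open>None\<close> adjoined; \<open>Some\<close> is the inclusion.\<close>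

definition adjoin_zero :: "('a, 'c) monoid_scheme \<Rightarrow> 'a option monoid" where
  "adjoin_zero G = \<lparr>carrier = insert None (Some ` carrier G),
     mult = (\<lambda>u v. case (u, v) of
               (Some g, Some h) \<Rightarrow> Some (g \<otimes>\<^bsub>G\<^esub> h)
             | _ \<Rightarrow> None),
     one = Some \<one>\<^bsub>G\<^esub>\<rparr>"

lemma monoid_adjoin_one: "is_sgroup X \<Longrightarrow> monoid (adjoin_one X)"
  by (rule monoidI) (auto simp: adjoin_one_def is_sgroup_def split: option.splits)

lemma monoid_adjoin_zero: "monoid G \<Longrightarrow> monoid (adjoin_zero G)"
  by (rule monoidI)
    (auto simp: adjoin_zero_def monoid.m_closed monoid.m_assoc monoid.one_closed
      monoid.l_one monoid.r_one split: option.splits)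


section \<open>Strong partial actions\<close>

text \<open>A partial action is a family of partial maps \<open>\<alpha> m\<close>, so that the domain and the image of
  the map belonging to \<open>m\<close> are \<open>dom (\<alpha> m)\<close> and \<open>ran (\<alpha> m)\<close>. Only the values of the family on
  the carrier of the monoid matter.\<close>

definition strong_partial_action ::
  "('m, 'c) monoid_scheme \<Rightarrow> 'a set \<Rightarrow> ('m \<Rightarrow> 'a \<rightharpoonup> 'a) \<Rightarrow> bool" where
  "strong_partial_action M A \<alpha> \<longleftrightarrow>
     (\<forall>m\<in>carrier M. dom (\<alpha> m) \<subseteq> A \<and> ran (\<alpha> m) \<subseteq> A) \<and>
     dom (\<alpha> \<one>\<^bsub>M\<^esub>) = A \<and> (\<forall>x\<in>A. \<alpha> \<one>\<^bsub>M\<^esub> x = Some x) \<and>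
     (\<forall>m\<in>carrier M. \<forall>n\<in>carrier M.
        {x. \<exists>y\<in>dom (\<alpha> n). \<alpha> m x = Some y} = dom (\<alpha> (n \<otimes>\<^bsub>M\<^esub> m)) \<inter> dom (\<alpha> m)) \<and>
     (\<forall>m\<in>carrier M. \<forall>n\<in>carrier M. \<forall>x\<in>{x. \<exists>y\<in>dom (\<alpha> n). \<alpha> m x = Some y}.
        (\<alpha> n \<circ>\<^sub>m \<alpha> m) x = \<alpha> (n \<otimes>\<^bsub>M\<^esub> m) x)"

definition global_action ::
  "('m, 'c) monoid_scheme \<Rightarrow> 'a set \<Rightarrow> ('m \<Rightarrow> 'a \<rightharpoonup> 'a) \<Rightarrow> bool" where
  "global_action M A \<alpha> \<longleftrightarrow>
     strong_partial_action M A \<alpha> \<and> (\<forall>m\<in>carrier M. dom (\<alpha> m) = A)"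

definition acts_by_sg_homs ::
  "('m, 'c) monoid_scheme \<Rightarrow> ('a, 'd) sgroup_scheme \<Rightarrow> ('m \<Rightarrow> 'a \<rightharpoonup> 'a) \<Rightarrow> bool" where
  "acts_by_sg_homs M X \<alpha> \<longleftrightarrow>
     (\<forall>m\<in>carrier M. subsgroup (dom (\<alpha> m)) X \<and>
        (\<forall>x\<in>dom (\<alpha> m). \<forall>y\<in>dom (\<alpha> m).
           the (\<alpha> m (x \<cdot>\<^bsub>X\<^esub> y)) = the (\<alpha> m x) \<cdot>\<^bsub>X\<^esub> the (\<alpha> m y)))"

definition sg_strong_partial_action ::
  "('m, 'c) monoid_scheme \<Rightarrow> ('a, 'd) sgroup_scheme \<Rightarrow> ('m \<Rightarrow> 'a \<rightharpoonup> 'a) \<Rightarrow> bool" where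
  "sg_strong_partial_action M X \<alpha> \<longleftrightarrow>
     strong_partial_action M (carrier X) \<alpha> \<and> acts_by_sg_homs M X \<alpha>"

definition sg_global_action ::
  "('m, 'c) monoid_scheme \<Rightarrow> ('a, 'd) sgroup_scheme \<Rightarrow> ('m \<Rightarrow> 'a \<rightharpoonup> 'a) \<Rightarrow> bool" where
  "sg_global_action M X \<alpha> \<longleftrightarrow>
     global_action M (carrier X) \<alpha> \<and> acts_by_sg_homs M X \<alpha>"


section \<open>Globalizations\<close>

definition action_morphism ::
  "('m, 'c) monoid_scheme \<Rightarrow> ('a, 'd) sgroup_scheme \<Rightarrow> ('m \<Rightarrow> 'a \<rightharpoonup> 'a) \<Rightarrow>
   ('b, 'e) sgroup_scheme \<Rightarrow> ('m \<Rightarrow> 'b \<rightharpoonup> 'b) \<Rightarrow> ('a \<Rightarrow> 'b) \<Rightarrow> bool" where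
  "action_morphism M X \<alpha> Y \<beta> \<iota> \<longleftrightarrow>
     \<iota> \<in> sg_hom X Y \<and>
     (\<forall>m\<in>carrier M. \<forall>x\<in>dom (\<alpha> m). \<beta> m (\<iota> x) = Some (\<iota> (the (\<alpha> m x))))"

definition is_globalization ::
  "('m, 'c) monoid_scheme \<Rightarrow> ('a, 'd) sgroup_scheme \<Rightarrow> ('m \<Rightarrow> 'a \<rightharpoonup> 'a) \<Rightarrow>
   ('b, 'e) sgroup_scheme \<Rightarrow> ('m \<Rightarrow> 'b \<rightharpoonup> 'b) \<Rightarrow> ('a \<Rightarrow> 'b) \<Rightarrow> bool" where
  "is_globalization M X \<alpha> Y \<beta> \<iota> \<longleftrightarrow>
     is_sgroup Y \<and> sg_global_action M Y \<beta> \<and> action_morphism M X \<alpha> Y \<beta> \<iota> \<and>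
     (\<forall>x\<in>carrier X. \<forall>y\<in>carrier X. \<forall>m\<in>carrier M.
        \<beta> m (\<iota> x) = Some (\<iota> y) \<longrightarrow> x \<in> dom (\<alpha> m) \<and> \<alpha> m x = Some y)"

text \<open>HOL cannot quantify existentially over the type of the elements of the semigroup \<open>Y\<close>.
  No generality is lost by taking words over pairs as elements: the subsemigroup of \<open>Y\<close> generated
  by the \<open>\<beta> m (\<iota> x)\<close> is already a globalization, and its elements can be named by
  words in the pairs \<open>(m, x)\<close>. The lemma \<open>globalizableI\<close> below shows that a globalization
  on an arbitrary type yields one on this type.\<close>

definition globalizable ::
  "('m, 'c) monoid_scheme \<Rightarrow> ('a, 'd) sgroup_scheme \<Rightarrow> ('m \<Rightarrow> 'a \<rightharpoonup> 'a) \<Rightarrow> bool" where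
  "globalizable M X \<alpha> \<longleftrightarrow>
     (\<exists>(Y :: ('m \<times> 'a) list sgroup) \<beta> \<iota>. is_globalization M X \<alpha> Y \<beta> \<iota>)"


section \<open>The conditions for monoids with an adjoined zero\<close>

text \<open>When the domains and images are ideals, all values of the partial maps occurring in
  \<open>LC1\<close> are defined. In \<open>LC2\<close>, \<open>\<alpha> None\<close> is the map belonging to
  the zero, while \<open>x\<close> and \<open>z\<close> may be the adjoined identity, which is also \<open>None\<close>; a product of three
  factors the middle one of which is \<open>Some y\<close> always lies in the image of \<open>X\<close>.\<close>

definition LC1 ::
  "('g, 'c) monoid_scheme \<Rightarrow> ('a, 'd) sgroup_scheme \<Rightarrow> ('g option \<Rightarrow> 'a \<rightharpoonup> 'a) \<Rightarrow> bool" where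
  "LC1 G X \<alpha> \<longleftrightarrow>
     (\<forall>g\<in>carrier G. \<forall>x\<in>carrier X. \<forall>y\<in>carrier X. \<forall>z\<in>carrier X.
        y \<in> dom (\<alpha> (Some g)) \<longrightarrow>
        the (\<alpha> (Some (inv\<^bsub>G\<^esub> g)) (the (\<alpha> (Some g) (x \<cdot>\<^bsub>X\<^esub> y)) \<cdot>\<^bsub>X\<^esub> z)) =
        x \<cdot>\<^bsub>X\<^esub> the (\<alpha> (Some (inv\<^bsub>G\<^esub> g)) (the (\<alpha> (Some g) y) \<cdot>\<^bsub>X\<^esub> z)))"

definition LC2 ::
  "('g, 'c) monoid_scheme \<Rightarrow> ('a, 'd) sgroup_scheme \<Rightarrow> ('g option \<Rightarrow> 'a \<rightharpoonup> 'a) \<Rightarrow> bool" where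
  "LC2 G X \<alpha> \<longleftrightarrow>
     (\<forall>m\<in>carrier (adjoin_zero G). \<forall>y\<in>dom (\<alpha> m).
      \<forall>x\<in>carrier (adjoin_one X). \<forall>z\<in>carrier (adjoin_one X).
      \<forall>u\<in>dom (\<alpha> None).
        x \<otimes>\<^bsub>adjoin_one X\<^esub> Some y \<otimes>\<^bsub>adjoin_one X\<^esub> z = Some u \<longrightarrow>
        (\<exists>v\<in>dom (\<alpha> None).
           x \<otimes>\<^bsub>adjoin_one X\<^esub> Some (the (\<alpha> m y)) \<otimes>\<^bsub>adjoin_one X\<^esub> z = Some v \<and>
           the (\<alpha> None u) = the (\<alpha> None v)))"


section \<open>Independence of the type of the globalization\<close>

lemma sg_global_actionI:
  assumes "monoid M" "is_sgroup Y"
    and B: "\<And>m y. m \<in> carrier M \<Longrightarrow> \<beta> m y = (if y \<in> carrier Y then Some (b m y) else None)"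
    and closed: "\<And>m y. m \<in> carrier M \<Longrightarrow> y \<in> carrier Y \<Longrightarrow> b m y \<in> carrier Y"
    and one: "\<And>y. y \<in> carrier Y \<Longrightarrow> b \<one>\<^bsub>M\<^esub> y = y"
    and mult: "\<And>m n y. m \<in> carrier M \<Longrightarrow> n \<in> carrier M \<Longrightarrow> y \<in> carrier Y \<Longrightarrow>
       b n (b m y) = b (n \<otimes>\<^bsub>M\<^esub> m) y"
    and hom: "\<And>m y z. m \<in> carrier M \<Longrightarrow> y \<in> carrier Y \<Longrightarrow> z \<in> carrier Y \<Longrightarrow>
       b m (y \<cdot>\<^bsub>Y\<^esub> z) = b m y \<cdot>\<^bsub>Y\<^esub> b m z"
  shows "sg_global_action M Y \<beta>"
proof -
  interpret monoid M by fact
  have dom: "dom (\<beta> m) = carrier Y" if "m \<in> carrier M" for m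
    using that by (auto simp: B dom_def)
  have ran: "ran (\<beta> m) \<subseteq> carrier Y" if "m \<in> carrier M" for m
    using that by (auto simp: B ran_def closed split: if_splits)
  have val: "\<beta> m y = Some (b m y)" if "m \<in> carrier M" "y \<in> carrier Y" for m y
    using that by (simp add: B)
  have pre: "{x. \<exists>y\<in>carrier Y. \<beta> m x = Some y} = carrier Y"
    if "m \<in> carrier M" "n \<in> carrier M" for m n
    using that by (auto simp: B closed split: if_splits)
  have "strong_partial_action M (carrier Y) \<beta>"
    unfolding strong_partial_action_def
    by (intro conjI ballI) (simp_all add: dom pre ran val one closed mult del: mem_Collect_eq)
  moreover have "acts_by_sg_homs M Y \<beta>"
    using assms(2)
    by (simp add: acts_by_sg_homs_def subsgroup_def is_sgroup_def dom val hom)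
  ultimately show ?thesis
    by (simp add: sg_global_action_def global_action_def dom)
qed

lemma sg_global_actionD:
  assumes "sg_global_action M Y \<beta>" "m \<in> carrier M" "y \<in> carrier Y"
  shows "\<beta> m y = Some (the (\<beta> m y))" "the (\<beta> m y) \<in> carrier Y"
    and "the (\<beta> \<one>\<^bsub>M\<^esub> y) = y"
    and "n \<in> carrier M \<Longrightarrow> the (\<beta> n (the (\<beta> m y))) = the (\<beta> (n \<otimes>\<^bsub>M\<^esub> m) y)"
    and "z \<in> carrier Y \<Longrightarrow> the (\<beta> m (y \<cdot>\<^bsub>Y\<^esub> z)) = the (\<beta> m y) \<cdot>\<^bsub>Y\<^esub> the (\<beta> m z)"
proof -
  have A: "strong_partial_action M (carrier Y) \<beta>" "acts_by_sg_homs M Y \<beta>"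
    and D: "\<And>k. k \<in> carrier M \<Longrightarrow> dom (\<beta> k) = carrier Y"
    using assms(1) by (auto simp: sg_global_action_def global_action_def)
  show 1: "\<beta> m y = Some (the (\<beta> m y))"
    using D[OF assms(2)] assms(3) by (metis domD option.sel)
  show 2: "the (\<beta> m y) \<in> carrier Y"
    using A(1) assms(2) 1 unfolding strong_partial_action_def by (meson ranI subsetD)
  show "the (\<beta> \<one>\<^bsub>M\<^esub> y) = y"
    using A(1) assms(3) by (auto simp: strong_partial_action_def)
  show "the (\<beta> n (the (\<beta> m y))) = the (\<beta> (n \<otimes>\<^bsub>M\<^esub> m) y)" if "n \<in> carrier M"
  proof -
    have "y \<in> {x. \<exists>z\<in>dom (\<beta> n). \<beta> m x = Some z}"
      using 1 2 D[OF that] by auto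
    then have "(\<beta> n \<circ>\<^sub>m \<beta> m) y = \<beta> (n \<otimes>\<^bsub>M\<^esub> m) y"
      using A(1) assms(2) that unfolding strong_partial_action_def by blast
    then show ?thesis using 1 by (metis map_comp_simps(2))
  qed
  show "the (\<beta> m (y \<cdot>\<^bsub>Y\<^esub> z)) = the (\<beta> m y) \<cdot>\<^bsub>Y\<^esub> the (\<beta> m z)" if "z \<in> carrier Y"
    using A(2) assms(2,3) that D[OF assms(2)] unfolding acts_by_sg_homs_def by blast
qed

fun sg_prod :: "('a, 'c) sgroup_scheme \<Rightarrow> 'a list \<Rightarrow> 'a" where
  "sg_prod Y [] = undefined"
| "sg_prod Y [y] = y"
| "sg_prod Y (y # z # zs) = y \<cdot>\<^bsub>Y\<^esub> sg_prod Y (z # zs)"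

lemma sg_prod_closed:
  assumes "is_sgroup Y" "ys \<noteq> []" "set ys \<subseteq> carrier Y"
  shows "sg_prod Y ys \<in> carrier Y"
  using assms(2,3)
proof (induction ys)
  case (Cons y ys)
  then show ?case using assms(1) by (cases ys) (simp_all add: is_sgroup_def)
qed simp

lemma sg_prod_append:
  assumes "is_sgroup Y" "ys \<noteq> []" "zs \<noteq> []" "set ys \<subseteq> carrier Y" "set zs \<subseteq> carrier Y"
  shows "sg_prod Y (ys @ zs) = sg_prod Y ys \<cdot>\<^bsub>Y\<^esub> sg_prod Y zs"
  using assms(2,4)
proof (induction ys)
  case (Cons y ys)
  show ?case
  proof (cases ys)
    case Nil
    then show ?thesis using assms(3) by (cases zs) auto
  next
    case (Cons y' ys')
    have y: "y \<in> carrier Y" "ys \<noteq> []" "set ys \<subseteq> carrier Y"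
      using \<open>set (y # ys) \<subseteq> carrier Y\<close> Cons by auto
    have "sg_prod Y ys \<in> carrier Y" "sg_prod Y zs \<in> carrier Y"
      using sg_prod_closed[OF assms(1)] y assms(3,5) by blast+
    then have "y \<cdot>\<^bsub>Y\<^esub> (sg_prod Y ys \<cdot>\<^bsub>Y\<^esub> sg_prod Y zs) = (y \<cdot>\<^bsub>Y\<^esub> sg_prod Y ys) \<cdot>\<^bsub>Y\<^esub> sg_prod Y zs"
      using assms(1) y(1) unfolding is_sgroup_def by metis
    moreover have "sg_prod Y (ys @ zs) = sg_prod Y ys \<cdot>\<^bsub>Y\<^esub> sg_prod Y zs"
      using Cons.IH y by blast
    ultimately show ?thesis
      using Cons by simp
  qed
qed simp

lemma globalizableI:
  fixes M :: "('m, 'c) monoid_scheme" and X :: "('a, 'd) sgroup_scheme"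
    and Y :: "('b, 'e) sgroup_scheme"
  assumes M: "monoid M" and \<alpha>: "sg_strong_partial_action M X \<alpha>"
    and glob: "is_globalization M X \<alpha> Y \<beta> \<iota>"
  shows "globalizable M X \<alpha>"
proof -
  interpret monoid M by fact
  have Y: "is_sgroup Y" and act: "sg_global_action M Y \<beta>"
    and iota: "\<And>x. x \<in> carrier X \<Longrightarrow> \<iota> x \<in> carrier Y"
      "\<And>x y. x \<in> carrier X \<Longrightarrow> y \<in> carrier X \<Longrightarrow> \<iota> (x \<cdot>\<^bsub>X\<^esub> y) = \<iota> x \<cdot>\<^bsub>Y\<^esub> \<iota> y"
    and mor: "\<And>m x. m \<in> carrier M \<Longrightarrow> x \<in> dom (\<alpha> m) \<Longrightarrow> \<beta> m (\<iota> x) = Some (\<iota> (the (\<alpha> m x)))"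
    and refl: "\<And>x y m. x \<in> carrier X \<Longrightarrow> y \<in> carrier X \<Longrightarrow> m \<in> carrier M \<Longrightarrow>
        \<beta> m (\<iota> x) = Some (\<iota> y) \<Longrightarrow> x \<in> dom (\<alpha> m) \<and> \<alpha> m x = Some y"
    using glob unfolding is_globalization_def action_morphism_def sg_hom_def Pi_def by blast+
  note act = sg_global_actionD[OF act]
  define b where "b m y = the (\<beta> m y)" for m y
  note act = act[folded b_def]
  define val where "val w = sg_prod Y (map (\<lambda>(m, x). b m (\<iota> x)) w)" for w :: "('m \<times> 'a) list"
  define W where "W = {w. w \<noteq> [] \<and> set w \<subseteq> carrier M \<times> carrier X}"
  define f where "f = inv_into W val"
  define S where "S = val ` W"
  have letters: "set (map (\<lambda>(m, x). b m (\<iota> x)) w) \<subseteq> carrier Y" if "w \<in> W" for w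
    using that by (auto simp: W_def act iota)
  have val_in: "val w \<in> carrier Y" if "w \<in> W" for w
    unfolding val_def by (rule sg_prod_closed[OF Y _ letters[OF that]]) (use that in \<open>auto simp: W_def\<close>)
  then have SY: "s \<in> carrier Y" if "s \<in> S" for s using that by (auto simp: S_def)
  have f: "val (f s) = s" if "s \<in> S" for s
    using that unfolding f_def S_def by (rule f_inv_into_f)
  have S_mult: "s \<cdot>\<^bsub>Y\<^esub> t \<in> S" if "s \<in> S" "t \<in> S" for s t
  proof -
    from that obtain v w where vw: "v \<in> W" "w \<in> W" "s = val v" "t = val w" by (auto simp: S_def)
    have "val (v @ w) = s \<cdot>\<^bsub>Y\<^esub> t"
      using sg_prod_append[OF Y _ _ letters[OF vw(1)] letters[OF vw(2)]] vw
      by (auto simp: val_def W_def)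
    moreover have "v @ w \<in> W" using vw by (auto simp: W_def)
    ultimately show ?thesis unfolding S_def by (metis imageI)
  qed
  have S_letter: "b m (\<iota> x) \<in> S" if "m \<in> carrier M" "x \<in> carrier X" for m x
    unfolding S_def by (rule image_eqI[of _ _ "[(m, x)]"]) (use that in \<open>auto simp: val_def W_def\<close>)
  have S_iota: "\<iota> x \<in> S" if "x \<in> carrier X" for x
    using S_letter[OF one_closed that] act(3)[OF one_closed iota(1)[OF that]] by simp
  have S_act': "b n (val w) \<in> S" if n: "n \<in> carrier M" and "w \<in> W" for n w
    using \<open>w \<in> W\<close>
  proof (induction w)
    case (Cons p w)
    obtain m x where p: "p = (m, x)" "m \<in> carrier M" "x \<in> carrier X"
      using Cons.prems by (cases p) (auto simp: W_def)
    have hd: "b n (b m (\<iota> x)) \<in> S"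
      using act(4)[OF p(2) iota(1)[OF p(3)] n] S_letter[OF _ p(3)] p(2) n by simp
    show ?case
    proof (cases "w = []")
      case True
      then show ?thesis using hd p by (simp add: val_def)
    next
      case False
      then have w: "w \<in> W" using Cons.prems by (auto simp: W_def)
      have "val (p # w) = b m (\<iota> x) \<cdot>\<^bsub>Y\<^esub> val w"
        using False p by (cases w) (auto simp: val_def)
      moreover have "b n (b m (\<iota> x) \<cdot>\<^bsub>Y\<^esub> val w) = b n (b m (\<iota> x)) \<cdot>\<^bsub>Y\<^esub> b n (val w)"
        using n p w by (intro act(5)) (auto intro: act iota val_in)
      ultimately show ?thesis using S_mult[OF hd Cons.IH[OF w]] by simp
    qed
  qed (simp add: W_def)
  have S_act: "b n s \<in> S" if "n \<in> carrier M" "s \<in> S" for n s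
    using S_act' that by (auto simp: S_def)
  define Z :: "('m \<times> 'a) list sgroup" where
    "Z = \<lparr>carrier = f ` S, sg_mult = (\<lambda>u v. f (val u \<cdot>\<^bsub>Y\<^esub> val v))\<rparr>"
  define \<gamma> where "\<gamma> m u = (if u \<in> carrier Z then Some (f (b m (val u))) else None)" for m u
  have Z: "is_sgroup Z"
    using Y SY by (auto simp: is_sgroup_def Z_def f S_mult)
  have "sg_global_action M Z \<gamma>"
    by (rule sg_global_actionI[OF M Z, where b = "\<lambda>m u. f (b m (val u))"])
      (auto simp: Z_def \<gamma>_def f S_mult S_act SY act(1,2,4,5) act(3)[OF one_closed])
  moreover have "action_morphism M X \<alpha> Z \<gamma> (\<lambda>x. f (\<iota> x))"
  proof -
    have "\<gamma> m (f (\<iota> x)) = Some (f (\<iota> (the (\<alpha> m x))))"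
      if m: "m \<in> carrier M" and x: "x \<in> dom (\<alpha> m)" "x \<in> carrier X" for m x
      using mor[OF m x(1)] by (simp add: \<gamma>_def Z_def f S_iota x b_def)
    moreover have "x \<in> carrier X" if "m \<in> carrier M" "x \<in> dom (\<alpha> m)" for m x
      using that \<alpha> by (auto simp: sg_strong_partial_action_def strong_partial_action_def)
    ultimately show ?thesis
      by (auto simp: action_morphism_def sg_hom_def Z_def f S_iota iota)
  qed
  moreover have "x \<in> dom (\<alpha> m) \<and> \<alpha> m x = Some y"
    if "x \<in> carrier X" "y \<in> carrier X" "m \<in> carrier M" "\<gamma> m (f (\<iota> x)) = Some (f (\<iota> y))" for x y m
  proof -
    have "f (b m (\<iota> x)) = f (\<iota> y)"
      using that by (auto simp: \<gamma>_def f S_iota split: if_splits)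
    then have "b m (\<iota> x) = \<iota> y" by (metis f S_act S_iota that(1-3))
    then show ?thesis
      using refl[OF that(1-3)] act(1)[OF that(3) iota(1)[OF that(1)]] by simp
  qed
  ultimately show ?thesis
    using Z unfolding globalizable_def is_globalization_def by blast
qed

end

theory Submission
  imports Defs "HOL-Library.Confluence"
begin

text \<open>Necessity is a computation in a globalization: translating the product of \<open>x\<close>, \<open>y\<close> and a
  translate of \<open>z\<close> gives \<open>LC1\<close>, and invariance of the zero map under the action gives \<open>LC2\<close>.

  For sufficiency let \<open>R\<close> be the image of the zero map, an ideal of \<open>X\<close> on which every element acts
  identically. A globalization is found inside the product of two global actions. The first one is
  made from the Rees quotient \<open>X/R\<close>: the semigroup of words over the enveloping \<open>G\<close>-set, where two
  adjacent letters lying in a common translate of \<open>X/R\<close> are replaced by their product. This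
  rewriting is confluent by \<open>LC1\<close>, so that distinct letters remain distinct; the zero of \<open>G\<^sup>0\<close> acts as
  the constant map to the zero of \<open>X/R\<close>. The second one is the quotient of \<open>X\<close> by the syntactic
  congruence of the zero map, with the trivial action; \<open>LC2\<close> says that this quotient map is
  equivariant. The first factor separates everything outside \<open>R\<close>, and the second one
  everything that concerns the values of the zero map.\<close>

section \<open>Partial actions\<close>

text \<open>The domain law and the composition law combine into one equation of options: both sides
  are defined with the same value, or both are undefined.\<close>

lemma strong_partial_actionD:
  assumes "strong_partial_action M A \<alpha>" "m \<in> carrier M" "\<alpha> m x = Some y"
  shows "x \<in> A" "y \<in> A" and "n \<in> carrier M \<Longrightarrow> \<alpha> n y = \<alpha> (n \<otimes>\<^bsub>M\<^esub> m) x"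
proof -
  have "dom (\<alpha> m) \<subseteq> A \<and> ran (\<alpha> m) \<subseteq> A"
    using assms(1,2) by (simp add: strong_partial_action_def)
  then show "x \<in> A" "y \<in> A"
    using assms(3) by (blast intro: ranI)+
  assume n: "n \<in> carrier M"
  let ?P = "{x. \<exists>y\<in>dom (\<alpha> n). \<alpha> m x = Some y}"
  have *: "?P = dom (\<alpha> (n \<otimes>\<^bsub>M\<^esub> m)) \<inter> dom (\<alpha> m)"
    using assms(1,2) n by (simp add: strong_partial_action_def)
  have **: "(\<exists>y\<in>dom (\<alpha> n). \<alpha> m x = Some y) \<longrightarrow> (\<alpha> n \<circ>\<^sub>m \<alpha> m) x = \<alpha> (n \<otimes>\<^bsub>M\<^esub> m) x"
    using assms(1,2) n by (simp add: strong_partial_action_def)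
  show "\<alpha> n y = \<alpha> (n \<otimes>\<^bsub>M\<^esub> m) x"
  proof (cases "y \<in> dom (\<alpha> n)")
    case True
    with ** show ?thesis using assms(3) by (metis map_comp_simps(2))
  next
    case False
    then have "x \<notin> ?P" using assms(3) by auto
    then have "x \<notin> dom (\<alpha> (n \<otimes>\<^bsub>M\<^esub> m))" using assms(3) * by blast
    with False show ?thesis by (metis domIff)
  qed
qed

lemma acts_by_sg_homsD:
  assumes "acts_by_sg_homs M X \<alpha>" "m \<in> carrier M" "\<alpha> m x = Some x'" "\<alpha> m y = Some y'"
  shows "\<alpha> m (x \<cdot>\<^bsub>X\<^esub> y) = Some (x' \<cdot>\<^bsub>X\<^esub> y')"
proof -
  have "x \<in> dom (\<alpha> m)" "y \<in> dom (\<alpha> m)" using assms by auto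
  then have "x \<cdot>\<^bsub>X\<^esub> y \<in> dom (\<alpha> m)" "the (\<alpha> m (x \<cdot>\<^bsub>X\<^esub> y)) = x' \<cdot>\<^bsub>X\<^esub> y'"
    using assms by (auto simp: acts_by_sg_homs_def subsgroup_def)
  then show ?thesis by auto
qed

text \<open>The quotient of \<open>W\<close> by the congruence \<open>r\<close> serves as
  globalization. All laws are stated on representatives and modulo \<open>r\<close>, because the
  intended \<open>b\<close> satisfies them only there: the constant word by which zero will act is
  not idempotent as a word. The passage from classes to the prescribed type is left to
  \<open>globalizableI\<close>.\<close>

lemma globalizable_modulo:
  fixes W :: "('w, 'e) sgroup_scheme"
  assumes M: "monoid M" and \<alpha>: "sg_strong_partial_action M X \<alpha>"
    and W: "is_sgroup W" and r: "equiv (carrier W) r" "r \<subseteq> carrier W \<times> carrier W"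
    and cong: "\<And>u u' v v'. (u, u') \<in> r \<Longrightarrow> (v, v') \<in> r \<Longrightarrow> (u \<cdot>\<^bsub>W\<^esub> v, u' \<cdot>\<^bsub>W\<^esub> v') \<in> r"
    and b: "\<And>m u u'. m \<in> carrier M \<Longrightarrow> (u, u') \<in> r \<Longrightarrow> (b m u, b m u') \<in> r"
    and one: "\<And>u. u \<in> carrier W \<Longrightarrow> (b \<one>\<^bsub>M\<^esub> u, u) \<in> r"
    and mult: "\<And>m n u. m \<in> carrier M \<Longrightarrow> n \<in> carrier M \<Longrightarrow> u \<in> carrier W \<Longrightarrow>
       (b n (b m u), b (n \<otimes>\<^bsub>M\<^esub> m) u) \<in> r"
    and hom: "\<And>m u v. m \<in> carrier M \<Longrightarrow> u \<in> carrier W \<Longrightarrow> v \<in> carrier W \<Longrightarrow>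
       (b m (u \<cdot>\<^bsub>W\<^esub> v), b m u \<cdot>\<^bsub>W\<^esub> b m v) \<in> r"
    and \<iota>: "\<And>x. x \<in> carrier X \<Longrightarrow> \<iota> x \<in> carrier W"
    and \<iota>_mult: "\<And>x y. x \<in> carrier X \<Longrightarrow> y \<in> carrier X \<Longrightarrow> (\<iota> (x \<cdot>\<^bsub>X\<^esub> y), \<iota> x \<cdot>\<^bsub>W\<^esub> \<iota> y) \<in> r"
    and mor: "\<And>m x y. m \<in> carrier M \<Longrightarrow> \<alpha> m x = Some y \<Longrightarrow> (b m (\<iota> x), \<iota> y) \<in> r"
    and refl: "\<And>m x y. m \<in> carrier M \<Longrightarrow> x \<in> carrier X \<Longrightarrow> y \<in> carrier X \<Longrightarrow>
       (b m (\<iota> x), \<iota> y) \<in> r \<Longrightarrow> \<alpha> m x = Some y"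
  shows "globalizable M X \<alpha>"
proof -
  interpret monoid M by fact
  define Y :: "'w set sgroup" where
    "Y = \<lparr>carrier = carrier W // r, sg_mult = (\<lambda>U V. \<Union>u\<in>U. \<Union>v\<in>V. r `` {u \<cdot>\<^bsub>W\<^esub> v})\<rparr>"
  define B where "B m U = (\<Union>u\<in>U. r `` {b m u})" for m U
  define \<beta> where "\<beta> m U = (if U \<in> carrier Y then Some (B m U) else None)" for m U
  have refl_r: "(u, u) \<in> r" if "u \<in> carrier W" for u
    using r(1) that by (simp add: equiv_def refl_on_def)
  have eq: "r `` {u} = r `` {v} \<longleftrightarrow> (u, v) \<in> r" if "u \<in> carrier W" for u v
  proof
    assume "r `` {u} = r `` {v}"
    then have "(v, u) \<in> r" using refl_r[OF that] by blast
    then show "(u, v) \<in> r" using r(1) by (meson equivE symE)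
  qed (rule equiv_class_eq[OF r(1)])
  have bW: "b m u \<in> carrier W" if "m \<in> carrier M" "u \<in> carrier W" for m u
    using b[OF that(1) refl_r[OF that(2)]] r(2) by blast
  have mW: "u \<cdot>\<^bsub>W\<^esub> v \<in> carrier W" if "u \<in> carrier W" "v \<in> carrier W" for u v
    using W that by (simp add: is_sgroup_def)
  have "congruent2 r r (\<lambda>u v. r `` {u \<cdot>\<^bsub>W\<^esub> v})"
  unfolding congruent2_def using equiv_class_eq[OF r(1)] cong by blast
  then have Ymult: "(r `` {u}) \<cdot>\<^bsub>Y\<^esub> (r `` {v}) = r `` {u \<cdot>\<^bsub>W\<^esub> v}"
    if "u \<in> carrier W" "v \<in> carrier W" for u v
    using UN_equiv_class2[OF r(1) r(1)] that by (simp add: Y_def)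
  have "congruent r (\<lambda>u. r `` {b m u})" if "m \<in> carrier M" for m
    unfolding congruent_def using equiv_class_eq[OF r(1)] b[OF that] by blast
  then have B: "B m (r `` {u}) = r `` {b m u}" if "m \<in> carrier M" "u \<in> carrier W" for m u
    unfolding B_def using that UN_equiv_class[OF r(1), of "\<lambda>u. r `` {b m u}" u] by blast
  have cl: "r `` {u} \<in> carrier Y" if "u \<in> carrier W" for u
    using that by (simp add: Y_def quotientI)
  have ex: "\<exists>u\<in>carrier W. U = r `` {u}" if "U \<in> carrier Y" for U
    using that by (auto simp: Y_def elim: quotientE)
  have Y: "is_sgroup Y"
    unfolding is_sgroup_def
  proof (intro conjI ballI)
    fix U V T assume "U \<in> carrier Y" "V \<in> carrier Y" "T \<in> carrier Y"
    then obtain u v t where *: "u \<in> carrier W" "v \<in> carrier W" "t \<in> carrier W"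
      "U = r `` {u}" "V = r `` {v}" "T = r `` {t}" by (meson ex)
    then show "(U \<cdot>\<^bsub>Y\<^esub> V) \<cdot>\<^bsub>Y\<^esub> T = U \<cdot>\<^bsub>Y\<^esub> (V \<cdot>\<^bsub>Y\<^esub> T)"
      using W by (simp add: Ymult mW is_sgroup_def)
  next
    fix U V assume "U \<in> carrier Y" "V \<in> carrier Y"
    then obtain u v where "u \<in> carrier W" "v \<in> carrier W" "U = r `` {u}" "V = r `` {v}"
      by (meson ex)
    then show "U \<cdot>\<^bsub>Y\<^esub> V \<in> carrier Y" by (simp add: Ymult cl mW)
  qed
  have "sg_global_action M Y \<beta>"
  proof (rule sg_global_actionI[OF M Y \<beta>_def])
    fix m U assume m: "m \<in> carrier M" and "U \<in> carrier Y"
    then obtain u where u: "u \<in> carrier W" "U = r `` {u}" by (meson ex)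
    with m show "B m U \<in> carrier Y" by (simp add: B bW cl)
    fix n assume n: "n \<in> carrier M"
    then show "B n (B m U) = B (n \<otimes>\<^bsub>M\<^esub> m) U"
      using m u by (simp add: B bW eq mult)
  next
    fix U assume "U \<in> carrier Y"
    then obtain u where "u \<in> carrier W" "U = r `` {u}" by (meson ex)
    then show "B \<one>\<^bsub>M\<^esub> U = U" by (simp add: B bW eq one)
  next
    fix m U V assume m: "m \<in> carrier M" and "U \<in> carrier Y" "V \<in> carrier Y"
    then obtain u v where "u \<in> carrier W" "v \<in> carrier W" "U = r `` {u}" "V = r `` {v}"
      by (meson ex)
    with m show "B m (U \<cdot>\<^bsub>Y\<^esub> V) = B m U \<cdot>\<^bsub>Y\<^esub> B m V"
      by (simp add: B Ymult bW mW eq hom)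
  qed
  moreover have "action_morphism M X \<alpha> Y \<beta> (\<lambda>x. r `` {\<iota> x})"
  proof -
    have X: "x \<in> carrier X" if "\<alpha> m x = Some y" "m \<in> carrier M" for m x y
      using \<alpha> that strong_partial_actionD(1) unfolding sg_strong_partial_action_def by metis
    have Xm: "\<iota> (x \<cdot>\<^bsub>X\<^esub> y) \<in> carrier W" if "x \<in> carrier X" "y \<in> carrier X" for x y
      using \<iota>_mult[OF that] r(2) by blast
    have "\<beta> m (r `` {\<iota> x}) = Some (r `` {\<iota> y})" if "m \<in> carrier M" "\<alpha> m x = Some y" for m x y
      using mor[OF that] X[OF that(2,1)] that(1) by (simp add: \<beta>_def B \<iota> cl eq bW)
    then show ?thesis
      by (auto simp: action_morphism_def sg_hom_def \<iota> cl Ymult eq Xm \<iota>_mult)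
  qed
  moreover have "\<alpha> m x = Some y"
    if "x \<in> carrier X" "y \<in> carrier X" "m \<in> carrier M" "\<beta> m (r `` {\<iota> x}) = Some (r `` {\<iota> y})" for x y m
    using that by (intro refl) (simp_all add: \<beta>_def cl \<iota> B eq bW)
  ultimately have "is_globalization M X \<alpha> Y \<beta> (\<lambda>x. r `` {\<iota> x})"
    using Y by (auto simp: is_globalization_def)
  then show ?thesis by (rule globalizableI[OF M \<alpha>])
qed


section \<open>Words over the enveloping set of a partial group action\<close>

text \<open>The data left once the action of zero has been divided out. \<open>act_act\<close> is an
  equation of options, so it also compares undefined values; \<open>LC\<close> is \<open>LC1\<close>
  with the intermediate values named \<open>u\<close> and \<open>v\<close>. As the range of
  \<open>\<gamma> g\<close> is the domain of \<open>\<gamma> (inv g)\<close>, the clause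
  \<open>dom_ideal\<close> covers ranges too.\<close>

locale ideal_partial_action = group G for G :: "('g, 'b) monoid_scheme" (structure) +
  fixes S :: "('s, 'd) sgroup_scheme" and \<gamma> :: "'g \<Rightarrow> 's \<rightharpoonup> 's"
  assumes sgroup: "is_sgroup S"
    and act_dom: "g \<in> carrier G \<Longrightarrow> \<gamma> g s = Some t \<Longrightarrow> s \<in> carrier S"
    and act_one: "s \<in> carrier S \<Longrightarrow> \<gamma> \<one> s = Some s"
    and act_act: "g \<in> carrier G \<Longrightarrow> h \<in> carrier G \<Longrightarrow> \<gamma> g s = Some t \<Longrightarrow> \<gamma> h t = \<gamma> (h \<otimes> g) s"
    and act_mult: "g \<in> carrier G \<Longrightarrow> \<gamma> g s = Some s' \<Longrightarrow> \<gamma> g t = Some t' \<Longrightarrow>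
      \<gamma> g (s \<cdot>\<^bsub>S\<^esub> t) = Some (s' \<cdot>\<^bsub>S\<^esub> t')"
    and dom_ideal: "g \<in> carrier G \<Longrightarrow> \<gamma> g s = Some s' \<Longrightarrow> t \<in> carrier S \<Longrightarrow>
      s \<cdot>\<^bsub>S\<^esub> t \<in> dom (\<gamma> g) \<and> t \<cdot>\<^bsub>S\<^esub> s \<in> dom (\<gamma> g)"
    and LC: "g \<in> carrier G \<Longrightarrow> x \<in> carrier S \<Longrightarrow> z \<in> carrier S \<Longrightarrow> \<gamma> g y = Some y' \<Longrightarrow>
      \<gamma> g (x \<cdot>\<^bsub>S\<^esub> y) = Some u \<Longrightarrow> \<gamma> (inv g) (y' \<cdot>\<^bsub>S\<^esub> z) = Some v \<Longrightarrow>
      \<gamma> (inv g) (u \<cdot>\<^bsub>S\<^esub> z) = Some (x \<cdot>\<^bsub>S\<^esub> v)"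
begin

text \<open>A point \<open>p\<close> of the enveloping \<open>G\<close>-set is encoded by the partial function sending \<open>h\<close> to the
  element \<open>h p\<close> whenever it lies in the image of \<open>S\<close>.\<close>

definition points :: "('g \<rightharpoonup> 's) set" where
  "points = {f. dom f \<subseteq> carrier G \<and>
     (\<forall>k s. f k = Some s \<longrightarrow> (\<forall>h\<in>carrier G. f h = \<gamma> (h \<otimes> inv k) s))}"

text \<open>The element \<open>h\<close> takes \<open>g p\<close> where \<open>h g\<close> takes
  \<open>p\<close>, so left translation of points is right translation of the argument.\<close>

definition shift :: "'g \<Rightarrow> ('g \<rightharpoonup> 's) \<Rightarrow> 'g \<rightharpoonup> 's" where
  "shift g f = (\<lambda>h. if h \<in> carrier G then f (h \<otimes> g) else None)"

text \<open>The embedding of \<open>S\<close>. For \<open>s\<close> in the carrier the coordinate at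
  \<open>\<one>\<close> is \<open>s\<close> itself, so \<open>s\<close> can be read off from its
  point.\<close>

definition point :: "'s \<Rightarrow> 'g \<rightharpoonup> 's" where
  "point s = (\<lambda>h. if h \<in> carrier G then \<gamma> h s else None)"

text \<open>The product is formed in a coordinate \<open>h\<close> where both factors are visible,
  that is, in a common translate of \<open>S\<close>; without such a translate there is no
  product.\<close>

definition point_mult :: "('g \<rightharpoonup> 's) \<Rightarrow> ('g \<rightharpoonup> 's) \<Rightarrow> ('g \<rightharpoonup> 's) \<Rightarrow> bool" where
  "point_mult p q r \<longleftrightarrow> {p, q, r} \<subseteq> points \<and>
     (\<exists>h a b. p h = Some a \<and> q h = Some b \<and> r h = Some (a \<cdot>\<^bsub>S\<^esub> b))"

inductive step :: "('g \<rightharpoonup> 's) list \<Rightarrow> ('g \<rightharpoonup> 's) list \<Rightarrow> bool" where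
  "point_mult p q r \<Longrightarrow> step (u @ [p, q] @ v) (u @ [r] @ v)"

section \<open>Points of the enveloping set and their translates\<close>

lemma pointsD:
  assumes "f \<in> points" "f k = Some s"
  shows "k \<in> carrier G" "h \<in> carrier G \<Longrightarrow> f h = \<gamma> (h \<otimes> inv k) s" "s \<in> carrier S"
proof -
  show f: "f h = \<gamma> (h \<otimes> inv k) s" if "h \<in> carrier G" for h
    using assms that by (simp add: points_def)
  show "k \<in> carrier G" using assms by (auto simp: points_def)
  \<comment> \<open>At \<open>h = k\<close> the equation becomes
    \<open>\<gamma> \<one> s = Some s\<close>, and domains lie in the carrier.\<close>
  then show "s \<in> carrier S"
    using f[of k] assms(2) act_dom[of \<one> s s] by simp
qed

lemma shift_points:
  assumes g: "g \<in> carrier G" and f: "f \<in> points"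
  shows "shift g f \<in> points"
  unfolding points_def
proof (intro CollectI conjI allI impI ballI)
  show "dom (shift g f) \<subseteq> carrier G" by (auto simp: shift_def split: if_splits)
  fix k s h assume "shift g f k = Some s" and h: "h \<in> carrier G"
  then have k: "k \<in> carrier G" "f (k \<otimes> g) = Some s" by (auto simp: shift_def split: if_splits)
  have "h \<otimes> g \<otimes> inv (k \<otimes> g) = h \<otimes> inv k"
    using g h k(1) by (simp add: inv_mult_group m_assoc) (simp add: m_assoc[symmetric])
  then show "shift g f h = \<gamma> (h \<otimes> inv k) s"
    using pointsD(2)[OF f k(2), of "h \<otimes> g"] g h by (simp add: shift_def)
qed

lemma shift_one: "f \<in> points \<Longrightarrow> shift \<one> f = f"
  unfolding shift_def points_def by (rule ext) (auto, metis domIff subsetD)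

lemma shift_shift: "g \<in> carrier G \<Longrightarrow> h \<in> carrier G \<Longrightarrow> shift h (shift g f) = shift (h \<otimes> g) f"
  by (auto simp: shift_def fun_eq_iff m_assoc)

lemma point_points: "point s \<in> points"
  unfolding points_def
proof (intro CollectI conjI allI impI ballI)
  show "dom (point s) \<subseteq> carrier G" by (auto simp: point_def split: if_splits)
  fix k t h assume "point s k = Some t" and h: "h \<in> carrier G"
  then have k: "k \<in> carrier G" "\<gamma> k s = Some t" by (auto simp: point_def split: if_splits)
  then show "point s h = \<gamma> (h \<otimes> inv k) t"
    using act_act[OF k(1) _ k(2), of "h \<otimes> inv k"] h by (simp add: point_def m_assoc)
qed

lemma shift_point: "g \<in> carrier G \<Longrightarrow> \<gamma> g s = Some t \<Longrightarrow> shift g (point s) = point t"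
  using act_act[of g _ s t] by (simp add: shift_def point_def fun_eq_iff)

lemma ex_point_at:
  assumes "k \<in> carrier G" "s \<in> carrier S"
  shows "\<exists>f\<in>points. f k = Some s"
proof (rule bexI)
  show "shift (inv k) (point s) \<in> points"
    using assms by (simp add: shift_points point_points)
  show "shift (inv k) (point s) k = Some s"
    using assms by (simp add: shift_def point_def act_one)
qed

section \<open>The partial product of points\<close>

lemma point_mult_points:
  assumes "s \<in> carrier S" "t \<in> carrier S"
  shows "point_mult (point s) (point t) (point (s \<cdot>\<^bsub>S\<^esub> t))"
proof -
  have "point u \<one> = Some u" if "u \<in> carrier S" for u
    using that by (simp add: point_def act_one)
  moreover have "s \<cdot>\<^bsub>S\<^esub> t \<in> carrier S"
    using sgroup assms by (simp add: is_sgroup_def)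
  ultimately show ?thesis
    unfolding point_mult_def using assms point_points by blast
qed

text \<open>The change from the coordinate \<open>h\<close> of the definition to \<open>k\<close> is
  the partial map of \<open>k \<otimes> inv h\<close>, a homomorphism on its domain; so the product
  does not depend on the coordinate.\<close>

lemma point_mult_at:
  assumes "point_mult p q r" "p k = Some a" "q k = Some b"
  shows "r k = Some (a \<cdot>\<^bsub>S\<^esub> b)"
proof -
  obtain h a' b' where h: "{p, q, r} \<subseteq> points"
    "p h = Some a'" "q h = Some b'" "r h = Some (a' \<cdot>\<^bsub>S\<^esub> b')"
    using assms(1) by (auto simp: point_mult_def)
  then have P: "p \<in> points" "q \<in> points" "r \<in> points" by simp_all
  have "k \<in> carrier G" "h \<in> carrier G"
    using pointsD(1)[OF P(1)] assms(2) h(2) by simp_all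
  moreover from this have "\<gamma> (k \<otimes> inv h) a' = Some a" "\<gamma> (k \<otimes> inv h) b' = Some b"
    "r k = \<gamma> (k \<otimes> inv h) (a' \<cdot>\<^bsub>S\<^esub> b')"
    using pointsD(2)[OF P(1) h(2)] pointsD(2)[OF P(2) h(3)] pointsD(2)[OF P(3) h(4)] assms(2,3)
    by simp_all
  ultimately show ?thesis using act_mult[of "k \<otimes> inv h"] by simp
qed

text \<open>The coordinate in which \<open>r\<close> was computed also computes \<open>r'\<close>,
  and a point is determined by any one of its defined coordinates.\<close>

lemma point_mult_unique:
  assumes "point_mult p q r" "point_mult p q r'"
  shows "r = r'"
proof -
  obtain h c where h: "r \<in> points" "r' \<in> points" "r h = Some c" "r' h = Some c"
    using assms(1) point_mult_at[OF assms(2)] assms(2) unfolding point_mult_def by auto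
  show ?thesis
  proof
    fix k show "r k = r' k"
    proof (cases "k \<in> carrier G")
      case True
      then show ?thesis using pointsD(2)[OF h(1,3)] pointsD(2)[OF h(2,4)] by simp
    next
      case False
      then have "k \<notin> dom r" "k \<notin> dom r'" using h by (auto simp: points_def)
      then show ?thesis by (metis domIff)
    qed
  qed
qed

text \<open>The assumption \<open>LC\<close> is exactly the resolution of this overlap.\<close>

lemma point_mult_assoc:
  assumes pq: "point_mult p q s" and qr: "point_mult q r t"
  shows "\<exists>w. point_mult s r w \<and> point_mult p t w"
proof -
  obtain h a b where h: "p h = Some a" "q h = Some b" "s h = Some (a \<cdot>\<^bsub>S\<^esub> b)"
    using pq by (auto simp: point_mult_def)
  obtain k b' c where k: "q k = Some b'" "r k = Some c" "t k = Some (b' \<cdot>\<^bsub>S\<^esub> c)"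
    using qr by (auto simp: point_mult_def)
  have P: "p \<in> points" "q \<in> points" "r \<in> points" "s \<in> points" "t \<in> points"
    using pq qr by (auto simp: point_mult_def)
  note h_in = pointsD(1)[OF P(1) h(1)] and k_in = pointsD(1)[OF P(2) k(1)]
  \<comment> \<open>The factors of \<open>p q\<close> are visible at \<open>h\<close>, those of
    \<open>q r\<close> at \<open>k\<close>; \<open>g\<close> carries the first coordinate to the
    second.\<close>
  define g where "g = k \<otimes> inv h"
  have g: "g \<in> carrier G" "inv g = h \<otimes> inv k"
    using h_in k_in by (auto simp: g_def inv_mult_group)
  have a: "a \<in> carrier S" and c: "c \<in> carrier S"
    using pointsD(3) P h(1) k(2) by blast+
  have b: "\<gamma> g b = Some b'" using pointsD(2)[OF P(2) h(2) k_in] k(1) by (simp add: g_def)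
  have b': "\<gamma> (inv g) b' = Some b" using pointsD(2)[OF P(2) k(1) h_in] h(2) by (simp add: g)
  \<comment> \<open>Since domains are ideals, \<open>p q\<close> is visible at \<open>k\<close> and
    \<open>q r\<close> at \<open>h\<close>, although \<open>p\<close> need not be visible at
    \<open>k\<close> nor \<open>r\<close> at \<open>h\<close>.\<close>
  obtain u where u: "\<gamma> g (a \<cdot>\<^bsub>S\<^esub> b) = Some u" using dom_ideal[OF g(1) b a] by blast
  obtain v where v: "\<gamma> (inv g) (b' \<cdot>\<^bsub>S\<^esub> c) = Some v"
    using dom_ideal[OF inv_closed[OF g(1)] b' c] by blast
  have sk: "s k = Some u" using pointsD(2)[OF P(4) h(3) k_in] u by (simp add: g_def)
  have th: "t h = Some v" using pointsD(2)[OF P(5) k(3) h_in] v by (simp add: g)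
  have "u \<cdot>\<^bsub>S\<^esub> c \<in> carrier S"
    using sgroup pointsD(3)[OF P(4) sk] c by (simp add: is_sgroup_def)
  \<comment> \<open>\<open>w\<close> is chosen as the product of \<open>s\<close> and
    \<open>r\<close> at \<open>k\<close>. That it is also the product of \<open>p\<close> and
    \<open>t\<close>, computed at \<open>h\<close>, is \<open>LC\<close>.\<close>
  then obtain w where w: "w \<in> points" "w k = Some (u \<cdot>\<^bsub>S\<^esub> c)"
    using ex_point_at[OF k_in] by blast
  have "w h = Some (a \<cdot>\<^bsub>S\<^esub> v)"
    using pointsD(2)[OF w h_in] LC[OF g(1) a c b u v] by (simp add: g)
  then have "point_mult s r w" "point_mult p t w"
    using P w sk k(2) h(1) th by (auto simp: point_mult_def)
  then show ?thesis by blast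
qed

lemma shift_point_mult:
  assumes "g \<in> carrier G" "point_mult p q r"
  shows "point_mult (shift g p) (shift g q) (shift g r)"
proof -
  obtain h a b where h: "p \<in> points" "q \<in> points" "r \<in> points"
    "p h = Some a" "q h = Some b" "r h = Some (a \<cdot>\<^bsub>S\<^esub> b)"
    using assms(2) by (auto simp: point_mult_def)
  have "h \<in> carrier G" using pointsD(1)[OF h(1,4)] .
  \<comment> \<open>The new coordinate at \<open>h \<otimes> inv g\<close> is the old one at
    \<open>h\<close>, so the translated product is formed there.\<close>
  then have "shift g f (h \<otimes> inv g) = f h" for f
    using assms(1) by (simp add: shift_def m_assoc)
  then show ?thesis
    using h assms(1) by (auto simp: point_mult_def shift_points intro!: exI[of _ "h \<otimes> inv g"])
qed

section \<open>Confluence of the rewriting of words\<close>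

lemma step_overlap:
  assumes "u @ [p, q] @ v = u' @ [p', q'] @ v'" "length u \<le> length u'"
    and pq: "point_mult p q r" and pq': "point_mult p' q' r'"
  shows "\<exists>w. step\<^sup>=\<^sup>= (u @ [r] @ v) w \<and> step\<^sup>=\<^sup>= (u' @ [r'] @ v') w"
proof -
  obtain x where x: "u' = u @ x" "[p, q] @ v = x @ [p', q'] @ v'"
    using assms(1,2) by (auto simp: append_eq_append_conv2)
  \<comment> \<open>\<open>x\<close> is the part of the word between the starts of the two redexes,
    which coincide, share one letter or are disjoint. The peak closes by uniqueness of products, by
    \<open>point_mult_assoc\<close>, or by performing the other replacement, with at most one step
    on each side.\<close>
  consider "x = []" | "x = [p]" | y where "x = [p, q] @ y"
    using x(2) by (cases x rule: list.exhaust[case_product list.exhaust[of "tl x"]]) auto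
  then show ?thesis
  proof cases
    case 1
    then show ?thesis using x point_mult_unique[OF pq] pq' by auto
  next
    case 2
    then have *: "p' = q" "v = q' # v'" using x(2) by auto
    then obtain w where "point_mult r q' w" "point_mult p r' w"
      using point_mult_assoc[OF pq] pq' by blast
    then have "step (u @ [r, q'] @ v') (u @ [w] @ v')" "step (u @ [p, r'] @ v') (u @ [w] @ v')"
      by (blast intro: step.intros)+
    then show ?thesis using * 2 x(1) by auto
  next
    case 3
    then have v: "v = y @ [p', q'] @ v'" using x(2) by simp
    have "step ((u @ [r] @ y) @ [p', q'] @ v') ((u @ [r] @ y) @ [r'] @ v')"
      "step (u @ [p, q] @ (y @ [r'] @ v')) (u @ [r] @ (y @ [r'] @ v'))"
      using pq pq' by (blast intro: step.intros)+
    then show ?thesis using 3 x(1) v by auto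
  qed
qed

text \<open>Since every peak closes within one step on each side, the rewriting is strongly
  confluent, and confluence follows without a termination argument.\<close>

lemma confluentp_step: "confluentp step"
proof (rule strong_confluentp_imp_confluentp, rule strong_confluentpI)
  fix x y z assume "step x y" "step x z"
  then have "\<exists>w. step\<^sup>=\<^sup>= y w \<and> step\<^sup>=\<^sup>= z w"
    by (elim step.cases) (metis (no_types, lifting) step_overlap nat_le_linear)
  then show "\<exists>w. step\<^sup>*\<^sup>* y w \<and> step\<^sup>=\<^sup>= z w" by blast
qed

text \<open>A step needs two adjacent letters, so words of one letter are irreducible; by confluence
  convertible ones have a common reduct and hence agree.\<close>

lemma equivclp_step_singleton:
  assumes "equivclp step [p] [q]"
  shows "p = q"
proof -
  have normal: "w = [p]" if "step\<^sup>*\<^sup>* [p] w" for p w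
    using that by (induction rule: rtranclp_induct) (auto elim!: step.cases simp: append_eq_Cons_conv)
  have "(step\<^sup>*\<^sup>* OO step\<inverse>\<inverse>\<^sup>*\<^sup>*) [p] [q]"
    using assms confluentp_step
    by (simp add: semiconfluentp_equivclp confluentp_eq_semiconfluentp)
  then obtain w where "step\<^sup>*\<^sup>* [p] w" "step\<^sup>*\<^sup>* [q] w"
    by (auto simp: rtranclp_conversep)
  then show ?thesis using normal[of p w] normal[of q w] by simp
qed

section \<open>Compatibility of convertibility with concatenation and translation\<close>

lemma equivclp_step_map:
  assumes f: "\<And>u v. step u v \<Longrightarrow> step (f u) (f v)" and "equivclp step u v"
  shows "equivclp step (f u) (f v)"
  using assms(2)
proof (induction rule: equivclp_induct)
  case (step y z)
  then show ?case using f by (metis equivclp_into_equivclp)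
qed simp

lemma equivclp_step_append:
  assumes "equivclp step u u'" "equivclp step v v'"
  shows "equivclp step (u @ v) (u' @ v')"
proof -
  have "step (x @ v) (y @ v)" "step (v @ x) (v @ y)" if "step x y" for x y v
    using that by (cases; metis append.assoc step.intros)+
  then have "equivclp step (u @ v) (u' @ v)" "equivclp step (u' @ v) (u' @ v')"
    using equivclp_step_map[OF _ assms(1), of "\<lambda>x. x @ v"]
      equivclp_step_map[OF _ assms(2), of "\<lambda>x. u' @ x"] by blast+
  then show ?thesis by (rule equivclp_trans)
qed

lemma equivclp_step_shift:
  assumes "g \<in> carrier G" "equivclp step u v"
  shows "equivclp step (map (shift g) u) (map (shift g) v)"
proof (rule equivclp_step_map[OF _ assms(2)])
  fix u v assume "step u v"
  then show "step (map (shift g) u) (map (shift g) v)"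
  proof cases
    case (1 p q r x y)
    then show ?thesis
      using step.intros[OF shift_point_mult[OF assms(1) 1(3)], of "map (shift g) x" "map (shift g) y"]
      by simp
  qed
qed

end

section \<open>Groups with an adjoined zero\<close>

locale zero_partial_action = group G for G :: "('g, 'b) monoid_scheme" (structure) +
  fixes X :: "('x, 'c) sgroup_scheme" and \<alpha> :: "'g option \<Rightarrow> 'x \<rightharpoonup> 'x"
  assumes sgroup_X: "is_sgroup X"
    and act: "sg_strong_partial_action (adjoin_zero G) X \<alpha>"
    and ideals: "\<forall>m\<in>carrier (adjoin_zero G). sg_ideal (dom (\<alpha> m)) X \<and> sg_ideal (ran (\<alpha> m)) X"
begin

lemma zero_carrier [simp]: "None \<in> carrier (adjoin_zero G)"
  "Some g \<in> carrier (adjoin_zero G) \<longleftrightarrow> g \<in> carrier G"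
  by (auto simp: adjoin_zero_def)

lemma zero_mult [simp]: "None \<otimes>\<^bsub>adjoin_zero G\<^esub> m = None" "m \<otimes>\<^bsub>adjoin_zero G\<^esub> None = None"
  "Some g \<otimes>\<^bsub>adjoin_zero G\<^esub> Some h = Some (g \<otimes> h)" "\<one>\<^bsub>adjoin_zero G\<^esub> = Some \<one>"
  by (auto simp: adjoin_zero_def split: option.splits)

lemma mult_X: "x \<in> carrier X \<Longrightarrow> y \<in> carrier X \<Longrightarrow> x \<cdot>\<^bsub>X\<^esub> y \<in> carrier X"
  using sgroup_X by (simp add: is_sgroup_def)

lemma act_X:
  assumes "m \<in> carrier (adjoin_zero G)" "\<alpha> m x = Some y"
  shows "x \<in> carrier X" "y \<in> carrier X"
    and "n \<in> carrier (adjoin_zero G) \<Longrightarrow> \<alpha> n y = \<alpha> (n \<otimes>\<^bsub>adjoin_zero G\<^esub> m) x"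
  using strong_partial_actionD[of "adjoin_zero G" "carrier X" \<alpha>, OF _ assms] act by (simp_all add: sg_strong_partial_action_def)

lemma act_X_one: "x \<in> carrier X \<Longrightarrow> \<alpha> (Some \<one>) x = Some x"
  using act by (simp add: sg_strong_partial_action_def strong_partial_action_def)

lemma act_X_mult:
  assumes "m \<in> carrier (adjoin_zero G)" "\<alpha> m x = Some x'" "\<alpha> m y = Some y'"
  shows "\<alpha> m (x \<cdot>\<^bsub>X\<^esub> y) = Some (x' \<cdot>\<^bsub>X\<^esub> y')"
  using acts_by_sg_homsD[of "adjoin_zero G" X \<alpha>, OF _ assms] act by (simp add: sg_strong_partial_action_def)

lemma act_X_inv:
  assumes "g \<in> carrier G" "\<alpha> (Some g) x = Some y"
  shows "\<alpha> (Some (inv g)) y = Some x"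
  using act_X(3)[OF _ assms(2), of "Some (inv g)"] act_X(1)[OF _ assms(2)] assms(1)
  by (simp add: act_X_one)

lemma act_X_dom:
  assumes "m \<in> carrier (adjoin_zero G)" "\<alpha> m x = Some x'" "y \<in> carrier X"
  shows "x \<cdot>\<^bsub>X\<^esub> y \<in> dom (\<alpha> m)" "y \<cdot>\<^bsub>X\<^esub> x \<in> dom (\<alpha> m)"
  using ideals[rule_format, OF assms(1)] assms(2,3) by (auto simp: sg_ideal_def)

text \<open>In the monoid \<open>m 0 = 0\<close>, so applying \<open>m\<close> to a value of the
  zero map changes nothing.\<close>

lemma act_ran_zero: "y \<in> ran (\<alpha> None) \<Longrightarrow> m \<in> carrier (adjoin_zero G) \<Longrightarrow> \<alpha> m y = Some y"
proof -
  assume y: "y \<in> ran (\<alpha> None)" and m: "m \<in> carrier (adjoin_zero G)"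
  then obtain x where x: "\<alpha> None x = Some y" by (auto simp: ran_def)
  then show "\<alpha> m y = Some y" using act_X(3)[OF _ x m] by simp
qed

text \<open>The inverse of \<open>g\<close> fixes \<open>y\<close> and also sends it back to
  \<open>x\<close>, so \<open>x = y\<close>. Hence no group element moves anything from outside the
  range of the zero map into it.\<close>

lemma act_into_ran_zero:
  assumes "g \<in> carrier G" "\<alpha> (Some g) x = Some y" "y \<in> ran (\<alpha> None)"
  shows "x \<in> ran (\<alpha> None)"
  using act_X_inv[OF assms(1,2)] act_ran_zero[OF assms(3), of "Some (inv g)"] assms(1,3) by simp

lemma ran_zero_ideal:
  assumes "x \<in> ran (\<alpha> None)" "y \<in> carrier X"
  shows "x \<cdot>\<^bsub>X\<^esub> y \<in> ran (\<alpha> None)" "y \<cdot>\<^bsub>X\<^esub> x \<in> ran (\<alpha> None)"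
  using ideals[rule_format, of None] assms by (simp_all add: sg_ideal_def)


subsection \<open>The Rees quotient by the image of the zero map\<close>

definition rees_class :: "'x \<Rightarrow> 'x option" where
  "rees_class x = (if x \<in> ran (\<alpha> None) then None else Some x)"

text \<open>The zero \<open>None\<close> is adjoined even if the range of the zero map is empty: its
  point is the letter to which zero will send every word.\<close>

definition rees :: "'x option sgroup" where
  "rees = \<lparr>carrier = insert None (rees_class ` carrier X),
     sg_mult = (\<lambda>u v. case (u, v) of (Some x, Some y) \<Rightarrow> rees_class (x \<cdot>\<^bsub>X\<^esub> y) | _ \<Rightarrow> None)\<rparr>"

text \<open>The guard keeps \<open>Some x\<close> with \<open>x\<close> in the collapsed ideal out
  of the domain, as it names no element of the quotient. Elsewhere \<open>Some\<close> already
  yields the class of the value, by \<open>act_into_ran_zero\<close>.\<close>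

definition rees_act :: "'g \<Rightarrow> 'x option \<rightharpoonup> 'x option" where
  "rees_act g u = (case u of None \<Rightarrow> Some None
     | Some x \<Rightarrow> if x \<in> ran (\<alpha> None) then None else map_option Some (\<alpha> (Some g) x))"

lemma rees_class_in: "x \<in> carrier X \<Longrightarrow> rees_class x \<in> carrier rees" "None \<in> carrier rees"
  by (simp_all add: rees_def)

lemma rees_cases:
  assumes "u \<in> carrier rees"
  obtains "u = None" | x where "x \<in> carrier X" "u = rees_class x"
  using assms by (auto simp: rees_def)

lemma rees_mult_None [simp]: "None \<cdot>\<^bsub>rees\<^esub> u = None" "u \<cdot>\<^bsub>rees\<^esub> None = None"
  by (auto simp: rees_def split: option.splits)

lemma rees_mult:
  "x \<in> carrier X \<Longrightarrow> y \<in> carrier X \<Longrightarrow> rees_class x \<cdot>\<^bsub>rees\<^esub> rees_class y = rees_class (x \<cdot>\<^bsub>X\<^esub> y)"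
  using ran_zero_ideal[of x y] ran_zero_ideal[of y x] by (simp add: rees_def rees_class_def)

lemma rees_act_None [simp]: "rees_act g None = Some None"
  by (simp add: rees_act_def)

lemma rees_act_class:
  "g \<in> carrier G \<Longrightarrow> \<alpha> (Some g) x = Some y \<Longrightarrow> rees_act g (rees_class x) = Some (rees_class y)"
  using act_into_ran_zero[of g x y] act_ran_zero[of x "Some g"]
  by (cases "x \<in> ran (\<alpha> None)") (simp_all add: rees_act_def rees_class_def, metis)

lemma rees_act_cases:
  assumes "g \<in> carrier G" "rees_act g u = Some v"
  obtains "u = None" "v = None"
    | x y where "u = rees_class x" "v = rees_class y" "\<alpha> (Some g) x = Some y"
      "x \<in> carrier X" "y \<in> carrier X"
proof (cases u)
  case None
  then show ?thesis using assms that(1) by simp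
next
  case (Some x)
  then obtain y where y: "x \<notin> ran (\<alpha> None)" "\<alpha> (Some g) x = Some y" "v = Some y"
    using assms by (auto simp: rees_act_def split: if_splits)
  then have "y \<notin> ran (\<alpha> None)" using act_into_ran_zero assms(1) by blast
  then show ?thesis
    using that(2)[of x y] y Some act_X(1,2)[OF _ y(2)] assms(1) by (simp add: rees_class_def)
qed

lemma is_sgroup_rees: "is_sgroup rees"
  unfolding is_sgroup_def
proof (intro conjI ballI)
  fix u v assume "u \<in> carrier rees" "v \<in> carrier rees"
  then show "u \<cdot>\<^bsub>rees\<^esub> v \<in> carrier rees"
    by (elim rees_cases) (simp_all add: rees_class_in rees_mult mult_X)
  fix w assume "w \<in> carrier rees"
  with \<open>u \<in> carrier rees\<close> \<open>v \<in> carrier rees\<close>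
  show "u \<cdot>\<^bsub>rees\<^esub> v \<cdot>\<^bsub>rees\<^esub> w = u \<cdot>\<^bsub>rees\<^esub> (v \<cdot>\<^bsub>rees\<^esub> w)"
    using sgroup_X by (elim rees_cases) (simp_all add: rees_mult mult_X is_sgroup_def)
qed

lemma ideal_partial_action_rees:
  assumes LC1: "LC1 G X \<alpha>"
  shows "ideal_partial_action G rees rees_act"
proof unfold_locales
  show "is_sgroup rees" by (rule is_sgroup_rees)
next
  fix g s t assume "g \<in> carrier G" "rees_act g s = Some t"
  then show "s \<in> carrier rees" by (cases rule: rees_act_cases) (simp_all add: rees_class_in)
next
  fix s assume "s \<in> carrier rees"
  then show "rees_act \<one> s = Some s"
    by (cases rule: rees_cases) (simp_all add: rees_act_class act_X_one)
next
  fix g h s t assume g: "g \<in> carrier G" "h \<in> carrier G" and st: "rees_act g s = Some t"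
  from g(1) st show "rees_act h t = rees_act (h \<otimes> g) s"
  proof (cases rule: rees_act_cases)
    case (2 x y)
    have eq: "\<alpha> (Some h) y = \<alpha> (Some (h \<otimes> g)) x"
      using act_X(3)[OF _ 2(3), of "Some h"] g by simp
    show ?thesis
    proof (cases "x \<in> ran (\<alpha> None)")
      case True
      then have "y = x" using act_ran_zero[OF True, of "Some g"] 2(3) g by simp
      then show ?thesis using 2 True by (simp add: rees_class_def)
    next
      case False
      then have "y \<notin> ran (\<alpha> None)" using act_into_ran_zero[OF g(1) 2(3)] by blast
      then show ?thesis using 2 False eq by (simp add: rees_class_def rees_act_def)
    qed
  qed simp
next
  fix g s s' t t' assume g: "g \<in> carrier G" and s: "rees_act g s = Some s'"
    and t: "rees_act g t = Some t'"
  from g s show "rees_act g (s \<cdot>\<^bsub>rees\<^esub> t) = Some (s' \<cdot>\<^bsub>rees\<^esub> t')"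
  proof (cases rule: rees_act_cases)
    case x: (2 x x')
    from g t show ?thesis
    proof (cases rule: rees_act_cases)
      case (2 y y')
      then show ?thesis
        using x act_X_mult[OF _ x(3) 2(3)] g by (simp add: rees_mult rees_act_class)
    qed simp
  qed simp
next
  fix g s s' t assume g: "g \<in> carrier G" and s: "rees_act g s = Some s'" and t: "t \<in> carrier rees"
  from g s show "s \<cdot>\<^bsub>rees\<^esub> t \<in> dom (rees_act g) \<and> t \<cdot>\<^bsub>rees\<^esub> s \<in> dom (rees_act g)"
  proof (cases rule: rees_act_cases)
    case x: (2 x x')
    from t show ?thesis
    proof (cases rule: rees_cases)
      case (2 y)
      then obtain u v where "\<alpha> (Some g) (x \<cdot>\<^bsub>X\<^esub> y) = Some u" "\<alpha> (Some g) (y \<cdot>\<^bsub>X\<^esub> x) = Some v"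
        using act_X_dom[OF _ x(3)] g by (meson domD zero_carrier(2))
      then show ?thesis using x 2 g by (simp add: rees_mult rees_act_class domIff)
    qed (simp add: domIff)
  qed (simp add: domIff)
next
  fix g x z y y' u v
  assume g: "g \<in> carrier G" and x: "x \<in> carrier rees" and z: "z \<in> carrier rees"
    and y: "rees_act g y = Some y'" and u: "rees_act g (x \<cdot>\<^bsub>rees\<^esub> y) = Some u"
    and v: "rees_act (inv g) (y' \<cdot>\<^bsub>rees\<^esub> z) = Some v"
  from g y show "rees_act (inv g) (u \<cdot>\<^bsub>rees\<^esub> z) = Some (x \<cdot>\<^bsub>rees\<^esub> v)"
  proof (cases rule: rees_act_cases)
    case 1
    then show ?thesis using u v by simp
  next
    case y0: (2 y0 y0')
    show ?thesis
    proof (cases "x = None \<or> z = None")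
      case True
      then show ?thesis using u v by auto
    next
      case False
      then obtain x0 z0 where x0: "x0 \<in> carrier X" "x = rees_class x0"
        and z0: "z0 \<in> carrier X" "z = rees_class z0"
        using x z by (metis rees_cases)
      have y0'_inv: "\<alpha> (Some (inv g)) y0' = Some y0" by (rule act_X_inv[OF g y0(3)])
      obtain u0 where u0: "\<alpha> (Some g) (x0 \<cdot>\<^bsub>X\<^esub> y0) = Some u0"
        using act_X_dom(2)[OF _ y0(3) x0(1)] g by auto
      obtain v0 where v0: "\<alpha> (Some (inv g)) (y0' \<cdot>\<^bsub>X\<^esub> z0) = Some v0"
        using act_X_dom(1)[OF _ y0'_inv z0(1)] g by auto
      \<comment> \<open>\<open>u0\<close> lies in the domain of the map of \<open>inv g\<close>,
        which is an ideal; so the \<open>the\<close> in \<open>LC1\<close> takes a genuine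
        value.\<close>
      have "u0 \<cdot>\<^bsub>X\<^esub> z0 \<in> dom (\<alpha> (Some (inv g)))"
        using act_X_dom(1)[OF _ act_X_inv[OF g u0] z0(1)] g by simp
      moreover have "the (\<alpha> (Some (inv g)) (u0 \<cdot>\<^bsub>X\<^esub> z0)) = x0 \<cdot>\<^bsub>X\<^esub> v0"
        using LC1 g x0(1) y0 z0(1) u0 v0 unfolding LC1_def by (metis domI option.sel)
      ultimately have *: "\<alpha> (Some (inv g)) (u0 \<cdot>\<^bsub>X\<^esub> z0) = Some (x0 \<cdot>\<^bsub>X\<^esub> v0)" by auto
      have "u = rees_class u0" "v = rees_class v0"
        using u v x0 y0 z0 rees_act_class[OF g u0] rees_act_class[OF inv_closed[OF g] v0]
        by (simp_all add: rees_mult)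
      moreover have "u0 \<in> carrier X" "v0 \<in> carrier X"
        using act_X(2)[OF _ u0] act_X(2)[OF _ v0] g by simp_all
      ultimately show ?thesis
        using rees_act_class[OF inv_closed[OF g] *] x0 z0 by (simp add: rees_mult)
    qed
  qed
qed


subsection \<open>The syntactic congruence of the zero map\<close>

text \<open>The largest congruence through which \<open>\<alpha> None\<close>, undefinedness
  included, factors; the adjoined identity provides the one-sided and empty contexts. With the
  middle factor in \<open>X\<close> the product is never \<open>None\<close>, so \<open>the\<close>
  is harmless.\<close>

definition zero_cong :: "('x \<times> 'x) set" where
  "zero_cong = {(u, v). u \<in> carrier X \<and> v \<in> carrier X \<and>
     (\<forall>x\<in>carrier (adjoin_one X). \<forall>z\<in>carrier (adjoin_one X).
        \<alpha> None (the (x \<otimes>\<^bsub>adjoin_one X\<^esub> Some u \<otimes>\<^bsub>adjoin_one X\<^esub> z)) =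
        \<alpha> None (the (x \<otimes>\<^bsub>adjoin_one X\<^esub> Some v \<otimes>\<^bsub>adjoin_one X\<^esub> z)))}"

lemma one_mult [simp]: "None \<otimes>\<^bsub>adjoin_one X\<^esub> x = x" "x \<otimes>\<^bsub>adjoin_one X\<^esub> None = x"
  "Some y \<otimes>\<^bsub>adjoin_one X\<^esub> Some z = Some (y \<cdot>\<^bsub>X\<^esub> z)"
  by (auto simp: adjoin_one_def split: option.splits)

lemma one_carrier [simp]: "None \<in> carrier (adjoin_one X)"
  "Some x \<in> carrier (adjoin_one X) \<longleftrightarrow> x \<in> carrier X"
  by (auto simp: adjoin_one_def)

lemma sandwich_in_ideal:
  assumes "sg_ideal I X" "y \<in> I" "x \<in> carrier (adjoin_one X)" "z \<in> carrier (adjoin_one X)"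
  shows "\<exists>u\<in>I. x \<otimes>\<^bsub>adjoin_one X\<^esub> Some y \<otimes>\<^bsub>adjoin_one X\<^esub> z = Some u"
proof -
  have I: "c \<cdot>\<^bsub>X\<^esub> i \<in> I" "i \<cdot>\<^bsub>X\<^esub> c \<in> I" if "i \<in> I" "c \<in> carrier X" for i c
    using assms(1) that by (simp_all add: sg_ideal_def)
  show ?thesis
    using assms(2-4) by (cases x; cases z) (simp_all add: I)
qed

lemma equiv_zero_cong: "equiv (carrier X) zero_cong"
proof (rule equivI)
  show "sym zero_cong"
    by (rule symI) (unfold zero_cong_def, clarify, metis)
  show "trans zero_cong"
    by (rule transI) (unfold zero_cong_def, clarify, metis)
  show "refl_on (carrier X) zero_cong"
    by (rule refl_onI) (simp add: zero_cong_def)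
  show "zero_cong \<subseteq> carrier X \<times> carrier X"
    by (unfold zero_cong_def, clarify)
qed

text \<open>A factor next to the tested element is absorbed into the context, by associativity in
  the monoid \<open>adjoin_one X\<close>. The left and right versions are then joined by
  transitivity.\<close>

lemma zero_cong_mult:
  assumes "(u, u') \<in> zero_cong" "(v, v') \<in> zero_cong"
  shows "(u \<cdot>\<^bsub>X\<^esub> v, u' \<cdot>\<^bsub>X\<^esub> v') \<in> zero_cong"
proof -
  interpret N: monoid "adjoin_one X" by (rule monoid_adjoin_one[OF sgroup_X])
  have X: "u \<in> carrier X" "u' \<in> carrier X" "v \<in> carrier X" "v' \<in> carrier X"
    using assms by (auto simp: zero_cong_def)
  have R: "(a \<cdot>\<^bsub>X\<^esub> w, b \<cdot>\<^bsub>X\<^esub> w) \<in> zero_cong"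
    and L: "(w \<cdot>\<^bsub>X\<^esub> a, w \<cdot>\<^bsub>X\<^esub> b) \<in> zero_cong"
    if ab: "(a, b) \<in> zero_cong" and w: "w \<in> carrier X" for a b w
  proof -
    have ab': "a \<in> carrier X" "b \<in> carrier X" using ab by (auto simp: zero_cong_def)
    have *: "\<alpha> None (the (x \<otimes>\<^bsub>adjoin_one X\<^esub> Some a \<otimes>\<^bsub>adjoin_one X\<^esub> z)) =
       \<alpha> None (the (x \<otimes>\<^bsub>adjoin_one X\<^esub> Some b \<otimes>\<^bsub>adjoin_one X\<^esub> z))"
      if "x \<in> carrier (adjoin_one X)" "z \<in> carrier (adjoin_one X)" for x z
      using ab that by (auto simp: zero_cong_def)
    have r: "x \<otimes>\<^bsub>adjoin_one X\<^esub> Some (c \<cdot>\<^bsub>X\<^esub> w) \<otimes>\<^bsub>adjoin_one X\<^esub> z =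
        x \<otimes>\<^bsub>adjoin_one X\<^esub> Some c \<otimes>\<^bsub>adjoin_one X\<^esub> (Some w \<otimes>\<^bsub>adjoin_one X\<^esub> z)"
      and l: "x \<otimes>\<^bsub>adjoin_one X\<^esub> Some (w \<cdot>\<^bsub>X\<^esub> c) \<otimes>\<^bsub>adjoin_one X\<^esub> z =
        (x \<otimes>\<^bsub>adjoin_one X\<^esub> Some w) \<otimes>\<^bsub>adjoin_one X\<^esub> Some c \<otimes>\<^bsub>adjoin_one X\<^esub> z"
      if "x \<in> carrier (adjoin_one X)" "z \<in> carrier (adjoin_one X)" "c \<in> carrier X" for x z c
      using that w by (simp_all add: N.m_assoc flip: one_mult(3))
    show "(a \<cdot>\<^bsub>X\<^esub> w, b \<cdot>\<^bsub>X\<^esub> w) \<in> zero_cong" "(w \<cdot>\<^bsub>X\<^esub> a, w \<cdot>\<^bsub>X\<^esub> b) \<in> zero_cong"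
      unfolding zero_cong_def using ab' w by (auto simp: r l mult_X intro!: *)
  qed
  have "(u \<cdot>\<^bsub>X\<^esub> v, u' \<cdot>\<^bsub>X\<^esub> v) \<in> zero_cong" "(u' \<cdot>\<^bsub>X\<^esub> v, u' \<cdot>\<^bsub>X\<^esub> v') \<in> zero_cong"
    using R L assms X by blast+
  then show ?thesis using equiv_zero_cong by (meson equivE transE)
qed

lemma zero_congD:
  assumes "(x, y) \<in> zero_cong"
  shows "\<alpha> None x = \<alpha> None y"
proof -
  have "\<alpha> None (the (None \<otimes>\<^bsub>adjoin_one X\<^esub> Some x \<otimes>\<^bsub>adjoin_one X\<^esub> None)) =
    \<alpha> None (the (None \<otimes>\<^bsub>adjoin_one X\<^esub> Some y \<otimes>\<^bsub>adjoin_one X\<^esub> None))"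
    using assms unfolding zero_cong_def by (blast intro: one_carrier)
  then show ?thesis by simp
qed

text \<open>\<open>LC2\<close> gives the equation only where the side of \<open>y\<close> is
  defined. For \<open>m\<close> in the group, the other direction is \<open>LC2\<close> for the
  inverse; for the zero, \<open>y\<close> lies in the ideal \<open>dom (\<alpha> None)\<close>, so
  that side is always defined.\<close>

lemma act_zero_cong:
  assumes LC2: "LC2 G X \<alpha>" and m: "m \<in> carrier (adjoin_zero G)" "\<alpha> m y = Some y'"
  shows "(y, y') \<in> zero_cong"
proof -
  have half: "\<alpha> None (the (x \<otimes>\<^bsub>adjoin_one X\<^esub> Some y \<otimes>\<^bsub>adjoin_one X\<^esub> z)) =
      \<alpha> None (the (x \<otimes>\<^bsub>adjoin_one X\<^esub> Some y' \<otimes>\<^bsub>adjoin_one X\<^esub> z))"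
    if m: "m \<in> carrier (adjoin_zero G)" "\<alpha> m y = Some y'"
      and xz: "x \<in> carrier (adjoin_one X)" "z \<in> carrier (adjoin_one X)"
      and d: "the (x \<otimes>\<^bsub>adjoin_one X\<^esub> Some y \<otimes>\<^bsub>adjoin_one X\<^esub> z) \<in> dom (\<alpha> None)"
    for m y y' x z
  proof -
    have "sg_ideal (carrier X) X" using mult_X by (simp add: sg_ideal_def)
    then obtain u where u: "x \<otimes>\<^bsub>adjoin_one X\<^esub> Some y \<otimes>\<^bsub>adjoin_one X\<^esub> z = Some u"
      using sandwich_in_ideal[OF _ act_X(1)[OF m] xz] by blast
    moreover have "y \<in> dom (\<alpha> m)" "u \<in> dom (\<alpha> None)" using m(2) d u by auto
    ultimately obtain v where "v \<in> dom (\<alpha> None)" "the (\<alpha> None u) = the (\<alpha> None v)"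
      "x \<otimes>\<^bsub>adjoin_one X\<^esub> Some y' \<otimes>\<^bsub>adjoin_one X\<^esub> z = Some v"
      using LC2 m xz unfolding LC2_def by (metis option.sel)
    then show ?thesis using u \<open>u \<in> dom (\<alpha> None)\<close> by auto
  qed
  have "\<alpha> None (the (x \<otimes>\<^bsub>adjoin_one X\<^esub> Some y \<otimes>\<^bsub>adjoin_one X\<^esub> z)) =
      \<alpha> None (the (x \<otimes>\<^bsub>adjoin_one X\<^esub> Some y' \<otimes>\<^bsub>adjoin_one X\<^esub> z))"
    if xz: "x \<in> carrier (adjoin_one X)" "z \<in> carrier (adjoin_one X)" for x z
  proof (cases m)
    case None
    then have "y \<in> dom (\<alpha> None)" using m by auto
    then have "the (x \<otimes>\<^bsub>adjoin_one X\<^esub> Some y \<otimes>\<^bsub>adjoin_one X\<^esub> z) \<in> dom (\<alpha> None)"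
      using sandwich_in_ideal[OF _ _ xz, of "dom (\<alpha> None)" y] ideals by fastforce
    then show ?thesis by (rule half[OF m xz])
  next
    case (Some g)
    then have "\<alpha> (Some (inv g)) y' = Some y" "Some (inv g) \<in> carrier (adjoin_zero G)"
      using m act_X_inv by simp_all
    then show ?thesis
      using half[OF m xz] half[of "Some (inv g)" y' y x z] xz
      by (metis domIff)
  qed
  then show ?thesis using act_X(1,2)[OF m] by (simp add: zero_cong_def)
qed

subsection \<open>Necessity and sufficiency\<close>

lemma monoid_zero: "monoid (adjoin_zero G)"
  by (intro monoid_adjoin_zero is_monoid)

section \<open>Necessity of the two conditions\<close>

lemma globalization_imp_LC:
  assumes glob: "is_globalization (adjoin_zero G) X \<alpha> Y \<beta> \<iota>"
  shows "LC1 G X \<alpha>" "LC2 G X \<alpha>"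
proof -
  define b where "b m y = the (\<beta> m y)" for m y
  have Y: "is_sgroup Y" and \<beta>: "sg_global_action (adjoin_zero G) Y \<beta>"
    and \<iota>: "\<And>x. x \<in> carrier X \<Longrightarrow> \<iota> x \<in> carrier Y"
    and \<iota>_mult: "\<And>x y. x \<in> carrier X \<Longrightarrow> y \<in> carrier X \<Longrightarrow> \<iota> (x \<cdot>\<^bsub>X\<^esub> y) = \<iota> x \<cdot>\<^bsub>Y\<^esub> \<iota> y"
    using glob by (auto simp: is_globalization_def action_morphism_def sg_hom_def)
  have assoc: "a \<cdot>\<^bsub>Y\<^esub> c \<cdot>\<^bsub>Y\<^esub> d = a \<cdot>\<^bsub>Y\<^esub> (c \<cdot>\<^bsub>Y\<^esub> d)"
    if "a \<in> carrier Y" "c \<in> carrier Y" "d \<in> carrier Y" for a c d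
    using Y that by (simp add: is_sgroup_def)
  have closed: "a \<cdot>\<^bsub>Y\<^esub> c \<in> carrier Y" if "a \<in> carrier Y" "c \<in> carrier Y" for a c
    using Y that by (simp add: is_sgroup_def)
  have mor: "b m (\<iota> x) = \<iota> y" if "m \<in> carrier (adjoin_zero G)" "\<alpha> m x = Some y" for m x y
    using glob that by (auto simp: b_def is_globalization_def action_morphism_def domIff)
  have refl: "\<alpha> m x = Some y"
    if "b m (\<iota> x) = \<iota> y" "m \<in> carrier (adjoin_zero G)" "x \<in> carrier X" "y \<in> carrier X" for m x y
    using glob that sg_global_actionD(1)[OF \<beta> that(2) \<iota>[OF that(3)]]
    by (simp add: b_def is_globalization_def)
  note b = sg_global_actionD(2,4,5)[OF \<beta>, folded b_def]
  have b_one: "b (Some \<one>) y = y" if "y \<in> carrier Y" for y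
    using sg_global_actionD(3)[OF \<beta> _ that, of None] by (simp add: b_def)
  \<comment> \<open>The reflection property of a globalization at the identity of the monoid is
    injectivity of \<open>\<iota>\<close>.\<close>
  have inj: "x = y" if "\<iota> x = \<iota> y" "x \<in> carrier X" "y \<in> carrier X" for x y
    using refl[of "Some \<one>" x y] that by (simp add: b_one \<iota> act_X_one)
  show "LC1 G X \<alpha>"
    unfolding LC1_def
  proof (intro ballI impI)
    fix g x y z
    assume g: "g \<in> carrier G" and x: "x \<in> carrier X" and z: "z \<in> carrier X"
      and "y \<in> dom (\<alpha> (Some g))"
    then obtain y' where y': "\<alpha> (Some g) y = Some y'" by blast
    obtain u where u: "\<alpha> (Some g) (x \<cdot>\<^bsub>X\<^esub> y) = Some u"
      using act_X_dom(2)[OF _ y' x] g by auto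
    \<comment> \<open>In \<open>Y\<close>, applying \<open>inv g\<close> to the product of the
      images of \<open>p'\<close> and \<open>z\<close> turns the first factor back into the image of
      \<open>p\<close>. For \<open>y\<close> and for \<open>x y\<close> this produces the same right
      factor.\<close>
    have translate: "\<exists>q. \<alpha> (Some (inv g)) (p' \<cdot>\<^bsub>X\<^esub> z) = Some q \<and> q \<in> carrier X \<and>
        \<iota> q = \<iota> p \<cdot>\<^bsub>Y\<^esub> b (Some (inv g)) (\<iota> z)"
      if p: "\<alpha> (Some g) p = Some p'" for p p'
    proof -
      have p': "\<alpha> (Some (inv g)) p' = Some p" by (rule act_X_inv[OF g p])
      then obtain q where q: "\<alpha> (Some (inv g)) (p' \<cdot>\<^bsub>X\<^esub> z) = Some q"
        using act_X_dom(1)[OF _ p' z] g by auto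
      have "p' \<in> carrier X" "q \<in> carrier X" using act_X[OF _ p] act_X[OF _ q] g by simp_all
      then show ?thesis
        using mor[OF _ q] mor[OF _ p'] q g z by (simp add: \<iota>_mult \<iota> b)
    qed
    obtain v where v: "\<alpha> (Some (inv g)) (y' \<cdot>\<^bsub>X\<^esub> z) = Some v" "v \<in> carrier X"
      "\<iota> v = \<iota> y \<cdot>\<^bsub>Y\<^esub> b (Some (inv g)) (\<iota> z)" using translate[OF y'] by blast
    obtain w where w: "\<alpha> (Some (inv g)) (u \<cdot>\<^bsub>X\<^esub> z) = Some w" "w \<in> carrier X"
      "\<iota> w = \<iota> (x \<cdot>\<^bsub>X\<^esub> y) \<cdot>\<^bsub>Y\<^esub> b (Some (inv g)) (\<iota> z)" using translate[OF u] by blast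
    have "y \<in> carrier X" using act_X(1)[OF _ y'] g by simp
    \<comment> \<open>Associativity in \<open>Y\<close> moves \<open>x\<close> out of a product
      whose last factor, the translate of \<open>z\<close>, need not come from
      \<open>X\<close>.\<close>
    then have "\<iota> w = \<iota> (x \<cdot>\<^bsub>X\<^esub> v)"
      using w(3) v g x z by (simp add: \<iota>_mult \<iota> assoc b)
    then have "w = x \<cdot>\<^bsub>X\<^esub> v" using inj w(2) v(2) x mult_X by blast
    then show "the (\<alpha> (Some (inv g)) (the (\<alpha> (Some g) (x \<cdot>\<^bsub>X\<^esub> y)) \<cdot>\<^bsub>X\<^esub> z)) =
      x \<cdot>\<^bsub>X\<^esub> the (\<alpha> (Some (inv g)) (the (\<alpha> (Some g) y) \<cdot>\<^bsub>X\<^esub> z))"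
      by (simp add: u y' v w)
  qed
  show "LC2 G X \<alpha>"
    unfolding LC2_def
  proof (intro ballI impI)
    fix m y x z u
    assume m: "m \<in> carrier (adjoin_zero G)" and "y \<in> dom (\<alpha> m)"
      and xz: "x \<in> carrier (adjoin_one X)" "z \<in> carrier (adjoin_one X)"
      and "u \<in> dom (\<alpha> None)"
      and u: "x \<otimes>\<^bsub>adjoin_one X\<^esub> Some y \<otimes>\<^bsub>adjoin_one X\<^esub> z = Some u"
    then obtain y' w where y': "\<alpha> m y = Some y'" and w: "\<alpha> None u = Some w" by blast
    have X: "y \<in> carrier X" "y' \<in> carrier X" "u \<in> carrier X" "w \<in> carrier X"
      using act_X[OF m y'] act_X[OF _ w] by simp_all
    \<comment> \<open>This is \<open>0 m = 0\<close> in the monoid.\<close>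
    have "b None (\<iota> y) = b None (\<iota> y')"
      using mor[OF m y'] b(2)[OF m \<iota>[OF X(1)], of None] by simp
    moreover obtain v where v: "x \<otimes>\<^bsub>adjoin_one X\<^esub> Some y' \<otimes>\<^bsub>adjoin_one X\<^esub> z = Some v" "v \<in> carrier X"
      using sandwich_in_ideal[OF _ X(2) xz] mult_X by (auto simp: sg_ideal_def)
    ultimately have "b None (\<iota> u) = b None (\<iota> v)"
      using u xz X by (cases x; cases z) (auto simp: \<iota>_mult \<iota> b mult_X closed)
    \<comment> \<open>Reflection yields that \<open>v\<close> is in the domain together with the
      value there.\<close>
    then have "\<alpha> None v = Some w"
      using mor[OF _ w] refl[of None v w] v X by simp
    then show "\<exists>v\<in>dom (\<alpha> None).
           x \<otimes>\<^bsub>adjoin_one X\<^esub> Some (the (\<alpha> m y)) \<otimes>\<^bsub>adjoin_one X\<^esub> z = Some v \<and>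
           the (\<alpha> None u) = the (\<alpha> None v)"
      using v w y' by (intro bexI[of _ v]) auto
  qed
qed

section \<open>Sufficiency of the two conditions\<close>

lemma LC_imp_globalizable:
  assumes LC1: "LC1 G X \<alpha>" and LC2: "LC2 G X \<alpha>"
  shows "globalizable (adjoin_zero G) X \<alpha>"
proof -
  interpret R: ideal_partial_action G rees rees_act
    by (rule ideal_partial_action_rees[OF LC1])
  \<comment> \<open>Words and elements of \<open>X\<close> are kept as representatives;
    \<open>r\<close> imposes convertibility on the first component and \<open>zero_cong\<close> on
    the second.\<close>
  define W :: "(('g \<rightharpoonup> 'x option) list \<times> 'x) sgroup" where
    "W = \<lparr>carrier = lists R.points \<times> carrier X, sg_mult = (\<lambda>(u, x) (v, y). (u @ v, x \<cdot>\<^bsub>X\<^esub> y))\<rparr>"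
  define r where "r = {((u, x), (v, y)) | u x v y. u \<in> lists R.points \<and> v \<in> lists R.points \<and>
    equivclp R.step u v \<and> (x, y) \<in> zero_cong}"
  \<comment> \<open>Zero sends every word to the letter of the zero class; the second component is
    never moved.\<close>
  define b where "b m = (\<lambda>(u, x :: 'x). (case m of None \<Rightarrow> [R.point None]
    | Some g \<Rightarrow> map (R.shift g) u, x))" for m
  define \<iota> where "\<iota> x = ([R.point (rees_class x)], x)" for x
  have r_iff [simp]: "((u, x), (v, y)) \<in> r \<longleftrightarrow> u \<in> lists R.points \<and> v \<in> lists R.points \<and>
    equivclp R.step u v \<and> (x, y) \<in> zero_cong" for u x v y
    by (simp add: r_def)
  have W_simps [simp]: "(u, x) \<in> carrier W \<longleftrightarrow> u \<in> lists R.points \<and> x \<in> carrier X"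
    "(u, x) \<cdot>\<^bsub>W\<^esub> (v, y) = (u @ v, x \<cdot>\<^bsub>X\<^esub> y)" for u x v y
    by (simp_all add: W_def)
  have b_simps [simp]: "b None (u, x) = ([R.point None], x)"
    "b (Some g) (u, x) = (map (R.shift g) u, x)" for g u x
    by (simp_all add: b_def)
  have zc_refl: "(x, x) \<in> zero_cong" if "x \<in> carrier X" for x
    using equiv_zero_cong that by (simp add: equiv_def refl_on_def)
  have zc_X: "x \<in> carrier X" "y \<in> carrier X" if "(x, y) \<in> zero_cong" for x y
    using that by (simp_all add: zero_cong_def)
  have mult_points: "equivclp R.step [R.point s, R.point t] [R.point (s \<cdot>\<^bsub>rees\<^esub> t)]"
    if "s \<in> carrier rees" "t \<in> carrier rees" for s t
    using R.step.intros[OF R.point_mult_points[OF that], of "[]" "[]"] by auto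
  have shift_lists: "map (R.shift g) u \<in> lists R.points"
    if "g \<in> carrier G" "u \<in> lists R.points" for g u
    using that by (auto simp: R.shift_points)
  have shift_zero: "R.shift g (R.point None) = R.point None" if "g \<in> carrier G" for g
    using that by (rule R.shift_point) simp
  show ?thesis
  proof (rule globalizable_modulo[OF monoid_zero act, of W r b \<iota>])
    show "is_sgroup W"
      using sgroup_X by (auto simp: W_def is_sgroup_def)
    show "r \<subseteq> carrier W \<times> carrier W"
      by (auto dest: zc_X)
    show "equiv (carrier W) r"
    proof (rule equivI)
      show "refl_on (carrier W) r" by (rule refl_onI) (auto intro: zc_refl)
      show "sym r"
        using equiv_zero_cong by (auto simp: sym_def equiv_def intro: equivclp_sym)
      show "trans r"
        using equiv_zero_cong by (auto simp: trans_def equiv_def intro: equivclp_trans)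
      show "r \<subseteq> carrier W \<times> carrier W" by (auto dest: zc_X)
    qed
  next
    fix p p' q q' assume "(p, p') \<in> r" "(q, q') \<in> r"
    then show "(p \<cdot>\<^bsub>W\<^esub> q, p' \<cdot>\<^bsub>W\<^esub> q') \<in> r"
      by (cases p; cases p'; cases q; cases q') (simp add: R.equivclp_step_append zero_cong_mult)
  next
    fix m p p' assume "m \<in> carrier (adjoin_zero G)" "(p, p') \<in> r"
    then show "(b m p, b m p') \<in> r"
      by (cases p; cases p'; cases m)
        (simp_all add: R.point_points R.equivclp_step_shift shift_lists del: in_lists_conv_set)
  next
    fix p assume "p \<in> carrier W"
    moreover have "map (R.shift \<one>) u = u" if "u \<in> lists R.points" for u
      using that by (intro map_idI) (auto simp: R.shift_one)
    ultimately show "(b \<one>\<^bsub>adjoin_zero G\<^esub> p, p) \<in> r"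
      by (cases p) (simp add: zc_refl del: in_lists_conv_set)
  next
    fix m n p
    assume "m \<in> carrier (adjoin_zero G)" "n \<in> carrier (adjoin_zero G)" "p \<in> carrier W"
    then show "(b n (b m p), b (n \<otimes>\<^bsub>adjoin_zero G\<^esub> m) p) \<in> r"
      by (cases p; cases m; cases n)
        (simp_all add: zc_refl R.point_points shift_zero R.shift_shift shift_lists comp_def
          del: in_lists_conv_set)
  next
    fix m p q assume "m \<in> carrier (adjoin_zero G)" "p \<in> carrier W" "q \<in> carrier W"
    \<comment> \<open>For the zero, the square of the zero letter has to be contracted to that
      letter, which holds only modulo \<open>r\<close>.\<close>
    then show "(b m (p \<cdot>\<^bsub>W\<^esub> q), b m p \<cdot>\<^bsub>W\<^esub> b m q) \<in> r"
      using mult_points[of None None]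
      by (cases p; cases q; cases m)
        (simp_all add: zc_refl mult_X R.point_points shift_lists rees_class_in equivclp_sym
          del: in_lists_conv_set)
  next
    fix x assume "x \<in> carrier X"
    then show "\<iota> x \<in> carrier W" by (simp add: \<iota>_def R.point_points)
  next
    fix x y assume "x \<in> carrier X" "y \<in> carrier X"
    then show "(\<iota> (x \<cdot>\<^bsub>X\<^esub> y), \<iota> x \<cdot>\<^bsub>W\<^esub> \<iota> y) \<in> r"
      using mult_points[of "rees_class x" "rees_class y"]
      by (simp add: \<iota>_def R.point_points zc_refl mult_X rees_class_in rees_mult equivclp_sym)
  next
    fix m x y assume m: "m \<in> carrier (adjoin_zero G)" and xy: "\<alpha> m x = Some y"
    \<comment> \<open>\<open>LC2\<close> enters here: the second component stays \<open>x\<close>,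
      which must be congruent to \<open>y\<close>.\<close>
    then have zc: "(x, y) \<in> zero_cong" by (rule act_zero_cong[OF LC2])
    show "(b m (\<iota> x), \<iota> y) \<in> r"
    proof (cases m)
      case None
      then have "rees_class y = None" using xy by (auto simp: rees_class_def ran_def)
      then show ?thesis using None zc by (simp add: \<iota>_def R.point_points)
    next
      case (Some g)
      then have "R.shift g (R.point (rees_class x)) = R.point (rees_class y)"
        using m xy by (intro R.shift_point rees_act_class) simp_all
      then show ?thesis using Some zc by (simp add: \<iota>_def R.point_points)
    qed
  next
    fix m x y
    assume m: "m \<in> carrier (adjoin_zero G)" and x: "x \<in> carrier X" and y: "y \<in> carrier X"
      and eq: "(b m (\<iota> x), \<iota> y) \<in> r"
    \<comment> \<open>The first component collapses the range of the zero map; the second one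
      retains the values of that map.\<close>
    have zero: "\<alpha> None x = \<alpha> None y"
      using eq by (cases m) (auto simp: \<iota>_def dest: zero_congD)
    have point_one: "R.point s \<one> = Some s" if "s \<in> carrier rees" for s
      using that by (simp add: R.point_def R.act_one)
    show "\<alpha> m x = Some y"
    proof (cases m)
      case None
      then have "R.point None = R.point (rees_class y)"
        using eq by (auto simp: \<iota>_def dest: R.equivclp_step_singleton)
      \<comment> \<open>The coordinate at \<open>\<one>\<close> recovers the class of
        \<open>y\<close>.\<close>
      then have "rees_class y = None"
        using point_one y by (metis option.sel rees_class_in)
      then have "y \<in> ran (\<alpha> None)" by (simp add: rees_class_def split: if_splits)
      then show ?thesis using act_ran_zero[of y None] zero None by simp
    next
      case (Some g)
      have g: "g \<in> carrier G" using m Some by simp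
      have "R.shift g (R.point (rees_class x)) = R.point (rees_class y)"
        using eq Some by (auto simp: \<iota>_def dest: R.equivclp_step_singleton)
      then have "R.shift g (R.point (rees_class x)) \<one> = Some (rees_class y)"
        using point_one y by (simp add: rees_class_in)
      then have act: "rees_act g (rees_class x) = Some (rees_class y)"
        using g by (simp add: R.shift_def R.point_def)
      show ?thesis
      proof (cases "x \<in> ran (\<alpha> None)")
        case True
        then have "rees_class y = None" using act by (simp add: rees_class_def)
        then have "y \<in> ran (\<alpha> None)" by (simp add: rees_class_def split: if_splits)
        \<comment> \<open>Both elements lie in the range of the zero map, which fixes them, so its
          equal values force equality.\<close>
        then have "y = x"
          using True zero act_ran_zero[of x None] act_ran_zero[of y None] by simp
        then show ?thesis using act_ran_zero[OF True m] by simp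
      next
        case False
        \<comment> \<open>Outside the collapsed ideal the Rees action shows the actual value, so
          \<open>rees_class y\<close> is not the zero class and determines \<open>y\<close>.\<close>
        then have "map_option Some (\<alpha> (Some g) x) = Some (rees_class y)"
          using act by (simp add: rees_class_def rees_act_def)
        then show ?thesis
          using Some by (auto simp: rees_class_def split: if_splits)
      qed
    qed
  qed
qed

end

theorem theorem3p31:
  fixes G :: "('g, 'b) monoid_scheme" and X :: "('x, 'c) sgroup_scheme"
    and \<alpha> :: "'g option \<Rightarrow> 'x \<rightharpoonup> 'x"
  assumes "group G" and "is_sgroup X"
    and "sg_strong_partial_action (adjoin_zero G) X \<alpha>"
    and "\<forall>m\<in>carrier (adjoin_zero G). sg_ideal (dom (\<alpha> m)) X \<and> sg_ideal (ran (\<alpha> m)) X"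
  shows "globalizable (adjoin_zero G) X \<alpha> \<longleftrightarrow> LC1 G X \<alpha> \<and> LC2 G X \<alpha>"
proof -
  interpret zero_partial_action G X \<alpha>
    using assms by (simp add: zero_partial_action_def zero_partial_action_axioms_def)
  show ?thesis
    using globalization_imp_LC LC_imp_globalizable unfolding globalizable_def by blast
qed

end
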